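(* Let $\mathcal{H}$ be a separable Hilbert space, $K\in B(\mathcal{H})$ an operator with closed range, $I$ a countable index set, and let $W=\{(W_i,\omega_i)\}_{i\in I}$ be a $K$-fusion frame for $\mathcal{H}$. For each $i\in I$ let $\{f_{ij}\}_{j\in J_i}$ be a frame for $W_i$ with frame bounds $A_i,B_i$, where $0<\inf_{i\in I}A_i\le\sup_{i\in I}B_i<\infty$, and let $\{\widetilde{f}_{ij}\}_{j\in J_i}$ be the canonical dual frame of $\{f_{ij}\}_{j\in J_i}$ (in $W_i$). Then: 1. $\{K^{*}\omega_i f_{ij}\}_{i\in I,j\in J_i}$ is a $K$-dual of $\{S_W^{-1}\pi_{S_W(R(K))}\omega_i\widetilde{f}_{ij}\}_{i\in I,j\in J_i}$. 2. $\{K^{*}S_W^{-1}\pi_{S_W(R(K))}\omega_i\widetilde{f}_{ij}\}_{i\in I,j\in J_i}$ is a $K$-dual of $\{\omega_i f_{ij}\}_{i\in I,j\in J_i}$.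
   Context: $B(\mathcal{H})$ is the space of bounded linear operators on $\mathcal{H}$, $R(K)$ is the range of $K$, and $\pi_V$ is the orthogonal projection of $\mathcal{H}$ onto a closed subspace $V$. The index sets $J_i$ are countable. A family $W=\{(W_i,\omega_i)\}_{i\in I}$ of closed subspaces $W_i\subseteq\mathcal{H}$ with weights $\omega_i>0$ is a $K$-fusion frame for $\mathcal{H}$ if there are constants $0<A\le B<\infty$ with $A\|K^*f\|^2\le\sum_{i\in I}\omega_i^2\|\pi_{W_i}f\|^2\le B\|f\|^2$ for all $f\in\mathcal{H}$. Its frame operator is $S_Wf=\sum_{i\in I}\omega_i^2\pi_{W_i}f$. Since $K$ has closed range, $S_W$ restricts to an invertible operator $R(K)\to S_W(R(K))$ with bounded inverse, and $S_W(R(K))$ is closed; $S_W^{-1}:S_W(R(K))\to R(K)$ denotes the inverse of this restriction. A sequence $\{g_k\}_k\subseteq\mathcal{H}$ is a $K$-frame for $\mathcal{H}$ if there are $A,B>0$ with $A\|K^*f\|^2\le\sum_k|\langle f,g_k\rangle|^2\le B\|f\|^2$ for all $f\in\mathcal{H}$. If $\{g_k\}_k$ is a $K$-frame, a Bessel sequence $\{h_k\}_k$ in $\mathcal{H}$ is called a $K$-dual of $\{g_k\}_k$ if $$Kf=\sum_k\langle f,h_k\rangle\,\pi_{R(K)}g_k,\qquad f\in\mathcal{H}.$$ The canonical dual frame of a frame $\{f_{ij}\}_{j\in J_i}$ of $W_i$ is $\{S_i^{-1}f_{ij}\}_{j\in J_i}$, where $S_i:W_i\to W_i$, $S_if=\sum_{j\in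 J_i}\langle f,f_{ij}\rangle f_{ij}$. *)

theory Defs
  imports "HOL-Analysis.Analysis"
begin

section \<open>Real and complex Hilbert spaces\<close>

text \<open>
  The scalar field of a Hilbert space is the field of real or of complex numbers.
  The class below describes exactly these two: every \<open>z\<close> is a root of the real quadratic
  polynomial \<open>X^2 - (z + conj z) X + z conj z\<close>, since \<open>z + conj z\<close> is real (expand
  \<open>(z + 1) conj (z + 1)\<close>).
\<close>

class real_or_complex = real_normed_field +
  fixes conj :: "'a \<Rightarrow> 'a"
  assumes conj_add: "conj (x + y) = conj x + conj y"
    and conj_mult: "conj (x * y) = conj x * conj y"
    and conj_scaleR: "conj (r *\<^sub>R x) = r *\<^sub>R conj x"
    and mult_conj: "x * conj x = (norm x)\<^sup>2 *\<^sub>R 1"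

instantiation real :: real_or_complex
begin
definition conj_real :: "real \<Rightarrow> real" where "conj_real x = x"
instance
  by standard (simp_all add: conj_real_def power2_eq_square)
end

instantiation complex :: real_or_complex
begin
definition conj_complex :: "complex \<Rightarrow> complex" where "conj_complex = cnj"
instance
  by standard (simp_all add: conj_complex_def complex_norm_square[symmetric] scaleR_conv_of_real)
end

text \<open>
  The library's class \<open>real_inner\<close> only covers real scalars. Here \<open>smul\<close> and \<open>ip\<close> are the
  scalar multiplication and the inner product over \<open>'k\<close>; the norm of the type is the one
  induced by \<open>ip\<close>. By polarization the real inner product of the type is then the real
  part of \<open>ip\<close>, so that requiring \<open>real_inner\<close> is no restriction. The inner product is
  linear in its first argument.
\<close>

locale hilbert_space = vector_space smul
  for smul :: "'k::real_or_complex \<Rightarrow> 'h::{real_inner,banach} \<Rightarrow> 'h" +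
  fixes ip :: "'h \<Rightarrow> 'h \<Rightarrow> 'k"
  assumes smul_of_real: "smul (of_real r) x = r *\<^sub>R x"
    and ip_add_left: "ip (x + y) z = ip x z + ip y z"
    and ip_smul_left: "ip (smul c x) y = c * ip x y"
    and ip_commute: "ip y x = conj (ip x y)"
    and ip_self: "ip x x = of_real ((norm x)\<^sup>2)"

lemma hilbert_space_real:
  "hilbert_space scaleR (inner :: 'h::{real_inner,banach} \<Rightarrow> 'h \<Rightarrow> real)"
  by unfold_locales
    (simp_all add: conj_real_def inner_commute inner_add algebra_simps power2_norm_eq_inner)

lemma hilbert_space_complex:
  "hilbert_space (*) (\<lambda>x y :: complex. x * cnj y)"
  by unfold_locales
    (simp_all add: conj_complex_def algebra_simps complex_norm_square[symmetric] scaleR_conv_of_real)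

definition bounded_operator ::
    "('k::real_or_complex \<Rightarrow> 'h::{real_inner,banach} \<Rightarrow> 'h) \<Rightarrow> ('h \<Rightarrow> 'h) \<Rightarrow> bool" where
  "bounded_operator smul T \<longleftrightarrow>
     Vector_Spaces.linear smul smul T \<and> (\<exists>C. \<forall>x. norm (T x) \<le> C * norm x)"

definition closed_subspace ::
    "('k::real_or_complex \<Rightarrow> 'h::{real_inner,banach} \<Rightarrow> 'h) \<Rightarrow> 'h set \<Rightarrow> bool" where
  "closed_subspace smul V \<longleftrightarrow> module.subspace smul V \<and> closed V"

definition hadjoint ::
    "('h \<Rightarrow> 'h \<Rightarrow> 'k::real_or_complex) \<Rightarrow> ('h::{real_inner,banach} \<Rightarrow> 'h) \<Rightarrow> 'h \<Rightarrow> 'h" where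
  "hadjoint ip T = (THE T'. \<forall>x y. ip (T x) y = ip x (T' y))"

definition orth_proj ::
    "('h \<Rightarrow> 'h \<Rightarrow> 'k::real_or_complex) \<Rightarrow> 'h::{real_inner,banach} set \<Rightarrow> 'h \<Rightarrow> 'h" where
  "orth_proj ip V f = (THE p. p \<in> V \<and> (\<forall>v\<in>V. ip (f - p) v = 0))"

section \<open>Frames\<close>

text \<open>
  Summation over countable index sets is unconditional. As \<open>infsum\<close> is \<open>0\<close> on
  families that are not summable, finiteness of the sums is stated separately.
\<close>

definition frame_of ::
    "('h \<Rightarrow> 'h \<Rightarrow> 'k::real_or_complex) \<Rightarrow> 'h::{real_inner,banach} set \<Rightarrow> 'j set \<Rightarrow> ('j \<Rightarrow> 'h)
      \<Rightarrow> real \<Rightarrow> real \<Rightarrow> bool" where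
  "frame_of ip V N g A B \<longleftrightarrow>
     0 < A \<and> A \<le> B \<and> (\<forall>j\<in>N. g j \<in> V) \<and>
     (\<forall>f\<in>V. (\<lambda>j. (norm (ip f (g j)))\<^sup>2) summable_on N \<and>
        A * (norm f)\<^sup>2 \<le> (\<Sum>\<^sub>\<infinity>j\<in>N. (norm (ip f (g j)))\<^sup>2) \<and>
        (\<Sum>\<^sub>\<infinity>j\<in>N. (norm (ip f (g j)))\<^sup>2) \<le> B * (norm f)\<^sup>2)"

definition frame_operator ::
    "('k::real_or_complex \<Rightarrow> 'h::{real_inner,banach} \<Rightarrow> 'h) \<Rightarrow> ('h \<Rightarrow> 'h \<Rightarrow> 'k)
      \<Rightarrow> 'j set \<Rightarrow> ('j \<Rightarrow> 'h) \<Rightarrow> 'h \<Rightarrow> 'h" where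
  "frame_operator smul ip N g f = (\<Sum>\<^sub>\<infinity>j\<in>N. smul (ip f (g j)) (g j))"

definition canonical_dual ::
    "('k::real_or_complex \<Rightarrow> 'h::{real_inner,banach} \<Rightarrow> 'h) \<Rightarrow> ('h \<Rightarrow> 'h \<Rightarrow> 'k)
      \<Rightarrow> 'h set \<Rightarrow> 'j set \<Rightarrow> ('j \<Rightarrow> 'h) \<Rightarrow> 'j \<Rightarrow> 'h" where
  "canonical_dual smul ip V N g j = inv_into V (frame_operator smul ip N g) (g j)"

definition bessel_sequence ::
    "('h \<Rightarrow> 'h \<Rightarrow> 'k::real_or_complex) \<Rightarrow> 'n set \<Rightarrow> ('n \<Rightarrow> 'h::{real_inner,banach}) \<Rightarrow> bool" where
  "bessel_sequence ip N h \<longleftrightarrow>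
     (\<exists>B>0. \<forall>f. (\<lambda>k. (norm (ip f (h k)))\<^sup>2) summable_on N \<and>
        (\<Sum>\<^sub>\<infinity>k\<in>N. (norm (ip f (h k)))\<^sup>2) \<le> B * (norm f)\<^sup>2)"

definition K_frame ::
    "('h \<Rightarrow> 'h \<Rightarrow> 'k::real_or_complex) \<Rightarrow> ('h::{real_inner,banach} \<Rightarrow> 'h)
      \<Rightarrow> 'n set \<Rightarrow> ('n \<Rightarrow> 'h) \<Rightarrow> bool" where
  "K_frame ip K N g \<longleftrightarrow>
     (\<exists>A>0. \<exists>B>0. \<forall>f. (\<lambda>k. (norm (ip f (g k)))\<^sup>2) summable_on N \<and>
        A * (norm (hadjoint ip K f))\<^sup>2 \<le> (\<Sum>\<^sub>\<infinity>k\<in>N. (norm (ip f (g k)))\<^sup>2) \<and>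
        (\<Sum>\<^sub>\<infinity>k\<in>N. (norm (ip f (g k)))\<^sup>2) \<le> B * (norm f)\<^sup>2)"

text \<open>\<open>K_dual smul ip K N h g\<close> means that \<open>h\<close> is a \<open>K\<close>-dual of \<open>g\<close>, in this order.\<close>

definition K_dual ::
    "('k::real_or_complex \<Rightarrow> 'h::{real_inner,banach} \<Rightarrow> 'h) \<Rightarrow> ('h \<Rightarrow> 'h \<Rightarrow> 'k)
      \<Rightarrow> ('h \<Rightarrow> 'h) \<Rightarrow> 'n set \<Rightarrow> ('n \<Rightarrow> 'h) \<Rightarrow> ('n \<Rightarrow> 'h) \<Rightarrow> bool" where
  "K_dual smul ip K N h g \<longleftrightarrow>
     K_frame ip K N g \<and> bessel_sequence ip N h \<and>
     (\<forall>f. ((\<lambda>k. smul (ip f (h k)) (orth_proj ip (range K) (g k))) has_sum K f) N)"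

section \<open>Fusion frames\<close>

definition K_fusion_frame ::
    "('k::real_or_complex \<Rightarrow> 'h::{real_inner,banach} \<Rightarrow> 'h) \<Rightarrow> ('h \<Rightarrow> 'h \<Rightarrow> 'k)
      \<Rightarrow> ('h \<Rightarrow> 'h) \<Rightarrow> 'i set \<Rightarrow> ('i \<Rightarrow> 'h set) \<Rightarrow> ('i \<Rightarrow> real) \<Rightarrow> bool" where
  "K_fusion_frame smul ip K I W \<omega> \<longleftrightarrow>
     (\<forall>i\<in>I. closed_subspace smul (W i) \<and> 0 < \<omega> i) \<and>
     (\<exists>A B. 0 < A \<and> A \<le> B \<and>
        (\<forall>f. (\<lambda>i. (\<omega> i)\<^sup>2 * (norm (orth_proj ip (W i) f))\<^sup>2) summable_on I \<and>
           A * (norm (hadjoint ip K f))\<^sup>2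
             \<le> (\<Sum>\<^sub>\<infinity>i\<in>I. (\<omega> i)\<^sup>2 * (norm (orth_proj ip (W i) f))\<^sup>2) \<and>
           (\<Sum>\<^sub>\<infinity>i\<in>I. (\<omega> i)\<^sup>2 * (norm (orth_proj ip (W i) f))\<^sup>2) \<le> B * (norm f)\<^sup>2))"

definition fusion_frame_operator ::
    "('h \<Rightarrow> 'h \<Rightarrow> 'k::real_or_complex) \<Rightarrow> 'i set \<Rightarrow> ('i \<Rightarrow> 'h::{real_inner,banach} set)
      \<Rightarrow> ('i \<Rightarrow> real) \<Rightarrow> 'h \<Rightarrow> 'h" where
  "fusion_frame_operator ip I W \<omega> f = (\<Sum>\<^sub>\<infinity>i\<in>I. (\<omega> i)\<^sup>2 *\<^sub>R orth_proj ip (W i) f)"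

definition inv_fusion_frame_operator ::
    "('h \<Rightarrow> 'h \<Rightarrow> 'k::real_or_complex) \<Rightarrow> ('h \<Rightarrow> 'h) \<Rightarrow> 'i set
      \<Rightarrow> ('i \<Rightarrow> 'h::{real_inner,banach} set) \<Rightarrow> ('i \<Rightarrow> real) \<Rightarrow> 'h \<Rightarrow> 'h" where
  "inv_fusion_frame_operator ip K I W \<omega> =
     inv_into (range K) (fusion_frame_operator ip I W \<omega>)"

end

theory Submission
  imports Defs
begin

text \<open>
  Local frames and their duals resolve the projections onto the subspaces,
  \<open>\<pi>\<^sub>i x = \<Sum>\<^sub>j \<langle>x, f\<^sub>i\<^sub>j\<rangle> d\<^sub>i\<^sub>j = \<Sum>\<^sub>j \<langle>x, d\<^sub>i\<^sub>j\<rangle> f\<^sub>i\<^sub>j\<close>, so that summing over \<open>i\<close> with the weights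
  \<open>\<omega>\<^sub>i\<^sup>2\<close> gives the fusion frame operator \<open>S\<close>. On the closed range of \<open>K\<close> the adjoint \<open>K\<^sup>*\<close>
  is bounded below (Baire category), hence \<open>S\<close> is coercive there, and \<open>T = S\<^sup>-\<^sup>1 \<pi>\<close> (with \<open>\<pi>\<close> the projection onto
  the image \<open>S(R(K))\<close>) is a bounded operator with \<open>T S v = v\<close> for \<open>v \<in> R(K)\<close>. The first duality is
  then \<open>\<langle>S K x, T\<^sup>* y\<rangle> = \<langle>K x, y\<rangle>\<close>, and the second \<open>\<langle>S T\<^sup>* K x, y\<rangle> = \<langle>K x, T S y\<rangle> = \<langle>K x, y\<rangle>\<close> for
  \<open>y \<in> R(K)\<close>. The lower \<open>K\<close>-frame bound in the first duality follows from the duality itself,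
  since it writes \<open>K\<^sup>* y\<close> as a synthesis of the coefficients of \<open>y\<close> by a Bessel sequence.
\<close>

section \<open>Real Hilbert and Banach spaces\<close>

text \<open>A minimising sequence for the distance from \<open>x\<close> to \<open>V\<close> is
  Cauchy by the parallelogram law. Its limit is a nearest point, and minimality along each line
  through it in \<open>V\<close> forces orthogonality.\<close>

lemma orthogonal_projection_exists:
  fixes V :: "'h::{real_inner,banach} set"
  assumes "closed V" and "subspace V"
  obtains p where "p \<in> V" and "\<And>v. v \<in> V \<Longrightarrow> inner (x - p) v = 0"
proof -
  define D where "D = (INF v\<in>V. (norm (x - v))\<^sup>2)"
  have V0: "0 \<in> V" using \<open>subspace V\<close> by (rule subspace_0)
  have bdd: "bdd_below ((\<lambda>v. (norm (x - v))\<^sup>2) ` V)"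
    by (rule bdd_belowI[of _ 0]) auto
  have D_le: "D \<le> (norm (x - v))\<^sup>2" if "v \<in> V" for v
    unfolding D_def using bdd that by (rule cINF_lower)
  have "\<exists>v\<in>V. (norm (x - v))\<^sup>2 < D + e" if "e > 0" for e
    using cINF_less_iff[OF _ bdd, of "D + e"] V0 that unfolding D_def by auto
  then have "\<forall>n. \<exists>v\<in>V. (norm (x - v))\<^sup>2 < D + inverse (real (Suc n))" by simp
  then obtain y where y: "\<And>n. y n \<in> V" "\<And>n. (norm (x - y n))\<^sup>2 < D + inverse (real (Suc n))"
    by metis
  \<comment> \<open>The midpoint of \<open>y m\<close> and \<open>y n\<close> lies in
    \<open>V\<close>, so its squared distance to \<open>x\<close> is at least \<open>D\<close>. In
    the parallelogram identity this cancels all but the two errors.\<close>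
  have par: "(norm (y m - y n))\<^sup>2 \<le> 2 * inverse (real (Suc m)) + 2 * inverse (real (Suc n))" for m n
  proof -
    have "(1/2) *\<^sub>R (y m + y n) \<in> V"
      using \<open>subspace V\<close> y(1) by (simp add: subspace_add subspace_scale)
    note D_le[OF this]
    moreover have "(norm (y m - y n))\<^sup>2 = 2 * (norm (x - y m))\<^sup>2 + 2 * (norm (x - y n))\<^sup>2
        - 4 * (norm (x - (1/2) *\<^sub>R (y m + y n)))\<^sup>2"
      by (simp add: power2_norm_eq_inner inner_diff inner_add inner_commute algebra_simps)
    ultimately show ?thesis using y(2)[of m] y(2)[of n] by linarith
  qed
  have "Cauchy y"
  proof (rule CauchyI)
    fix e :: real assume "e > 0"
    \<comment> \<open>With this choice each of the two terms in \<open>par\<close> is below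
      \<open>e\<^sup>2 / 2\<close>.\<close>
    obtain M where M: "inverse (real (Suc M)) < e\<^sup>2 / 4"
      using reals_Archimedean[of "e\<^sup>2 / 4"] \<open>e > 0\<close> by auto
    have "norm (y m - y n) < e" if "m \<ge> M" "n \<ge> M" for m n
    proof -
      have "inverse (real (Suc m)) \<le> inverse (real (Suc M))" "inverse (real (Suc n)) \<le> inverse (real (Suc M))"
        using that by (simp_all add: field_simps)
      then have "(norm (y m - y n))\<^sup>2 < e\<^sup>2"
        using par[of m n] M by linarith
      then show ?thesis using \<open>e > 0\<close> by (simp add: power_less_imp_less_base)
    qed
    then show "\<exists>M. \<forall>m\<ge>M. \<forall>n\<ge>M. norm (y m - y n) < e" by blast
  qed
  then obtain p where p: "y \<longlonglongrightarrow> p"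
    using Cauchy_convergent_iff convergent_def by blast
  have "p \<in> V" using \<open>closed V\<close> y(1) p by (meson closed_sequentially)
  have "(\<lambda>n. (norm (x - y n))\<^sup>2) \<longlonglongrightarrow> (norm (x - p))\<^sup>2"
    by (intro tendsto_intros p)
  moreover have "(\<lambda>n. D + inverse (real (Suc n))) \<longlonglongrightarrow> D + 0"
    by (intro tendsto_intros LIMSEQ_inverse_real_of_nat)
  ultimately have min: "(norm (x - p))\<^sup>2 \<le> D"
    using y(2) by (auto intro: LIMSEQ_le less_imp_le)
  have "inner (x - p) v = 0" if "v \<in> V" for v
  proof (cases "v = 0")
    case False
    \<comment> \<open>This \<open>t\<close> minimises the quadratic polynomial giving the squared
      distance from \<open>x\<close> to \<open>p + t *\<^sub>R v\<close>. Its minimum lies below the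
      value at \<open>p\<close> by the squared inner product over
      \<open>(norm v)\<^sup>2\<close>.\<close>
    define t where "t = inner (x - p) v / (norm v)\<^sup>2"
    have "p + t *\<^sub>R v \<in> V"
      using \<open>subspace V\<close> \<open>p \<in> V\<close> that by (simp add: subspace_add subspace_scale)
    then have "(norm (x - p))\<^sup>2 \<le> (norm (x - (p + t *\<^sub>R v)))\<^sup>2"
      using min by (blast intro: order_trans D_le)
    also have "\<dots> = (norm (x - p))\<^sup>2 - 2 * t * inner (x - p) v + t\<^sup>2 * (norm v)\<^sup>2"
    proof -
      have "(norm (w - t *\<^sub>R v))\<^sup>2 = (norm w)\<^sup>2 - 2 * t * inner w v + t\<^sup>2 * (norm v)\<^sup>2" for w
        unfolding power2_norm_eq_inner
        by (simp add: inner_diff_left inner_diff_right inner_commute[of v w] power2_eq_square[of t] right_diff_distrib)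
      from this[of "x - p"] show ?thesis by (simp add: diff_diff_eq)
    qed
    also have "\<dots> = (norm (x - p))\<^sup>2 - (inner (x - p) v)\<^sup>2 / (norm v)\<^sup>2"
      using False by (simp add: t_def field_simps power2_eq_square)
    finally have "(inner (x - p) v)\<^sup>2 / (norm v)\<^sup>2 \<le> 0" by simp
    then show ?thesis using False by (simp add: divide_le_0_iff)
  qed simp
  with \<open>p \<in> V\<close> show thesis by (rule that)
qed

text \<open>The kernel is a closed hyperplane, and the residue \<open>u\<close> of a point outside
  it is a normal vector. Subtracting the right multiple of \<open>u\<close> moves any
  \<open>v\<close> into the kernel, which leaves only the scaling of \<open>u\<close> to
  determine.\<close>

lemma riesz_representation:
  fixes \<phi> :: "'h::{real_inner,banach} \<Rightarrow> real"
  assumes "bounded_linear \<phi>"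
  obtains z where "\<And>x. \<phi> x = inner x z"
proof (cases "\<forall>x. \<phi> x = 0")
  case True
  then show thesis using that[of 0] by simp
next
  case False
  interpret bounded_linear \<phi> by fact
  from False obtain x where x: "\<phi> x \<noteq> 0" by blast
  let ?V = "{v. \<phi> v = 0}"
  have "closed ?V"
    by (intro closed_Collect_eq continuous_intros linear_continuous_on assms)
  moreover have "subspace ?V"
    by (auto simp: subspace_def add scaleR zero)
  ultimately obtain p where p: "\<phi> p = 0" "\<And>v. \<phi> v = 0 \<Longrightarrow> inner (x - p) v = 0"
    by (elim orthogonal_projection_exists[of ?V x]) auto
  define u where "u = x - p"
  have u: "\<phi> u \<noteq> 0" "u \<noteq> 0" using x p(1) by (auto simp: u_def diff)
  have "\<phi> v = inner v ((\<phi> u / (norm u)\<^sup>2) *\<^sub>R u)" for v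
  proof -
    have "\<phi> (v - (\<phi> v / \<phi> u) *\<^sub>R u) = 0"
      using u by (simp add: diff scaleR)
    from p(2)[OF this] have "inner v u = \<phi> v / \<phi> u * (norm u)\<^sup>2"
      by (simp add: u_def[symmetric] inner_diff inner_commute power2_norm_eq_inner)
    then show ?thesis using u by simp
  qed
  then show thesis by (rule that)
qed

text \<open>This is the Baire half of the open mapping theorem. The iteration that would remove the
  closure is left out: approximate preimages of controlled norm suffice to estimate a continuous
  functional at \<open>v\<close>.\<close>

lemma closed_range_approx:
  fixes K :: "'a::real_normed_vector \<Rightarrow> 'h::banach"
  assumes K: "bounded_linear K" and cl: "closed (range K)"
  obtains C where "C > 0"
    and "\<And>v. v \<in> range K \<Longrightarrow> v \<in> closure (K ` cball 0 (C * norm v))"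
proof -
  interpret bounded_linear K by fact
  let ?X = "top_of_set (range K)"
  \<comment> \<open>These countably many closed sets cover the range, which is completely metrizable
    as a closed set, so one of them has interior points relative to the range.\<close>
  let ?F = "\<lambda>n::nat. closure (K ` cball 0 (real n))"
  have F_sub: "?F n \<subseteq> range K" for n
    using cl by (simp add: closure_minimal image_mono)
  have "completely_metrizable_space ?X"
    using cl completely_metrizable_space_closedin completely_metrizable_space_euclidean
    by (metis closed_closedin)
  moreover have "\<Union> (range ?F) = range K"
  proof
    show "range K \<subseteq> \<Union> (range ?F)"
    proof clarify
      fix x :: 'a
      obtain n where "norm x \<le> real n" using real_arch_simple by blast
      then have "K x \<in> ?F n" using closure_subset by fastforce
      then show "K x \<in> \<Union> (range ?F)" by blast
    qed
  qed (use F_sub in blast)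
  then have "?X interior_of \<Union> (range ?F) \<noteq> {}"
    by (metis image_is_empty UNIV_not_empty interior_of_topspace topspace_euclidean_subtopology)
  ultimately obtain n where n: "?X interior_of (?F n) \<noteq> {}"
    using Baire_category_alt[of ?X "range ?F"] closed_subset[OF F_sub closed_closure]
      countable_image[OF countableI_type, of ?F UNIV] by blast
  then obtain y where "y \<in> ?X interior_of (?F n)" by blast
  then obtain T where T: "openin ?X T" "y \<in> T" "T \<subseteq> ?F n"
    unfolding interior_of_def by blast
  then obtain r where r: "r > 0" "ball y r \<inter> range K \<subseteq> T" and y: "y \<in> range K"
    by (meson openin_contains_ball subsetD)
  \<comment> \<open>Below, \<open>v\<close> is scaled by \<open>s = r / (2 * norm v)\<close> to stay
    within \<open>r\<close> of \<open>y\<close>. A difference of two preimages of norm at most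
    \<open>n\<close>, divided by \<open>s\<close>, has norm at most
    \<open>4 * n * norm v / r\<close>. \<open>Suc\<close> keeps \<open>C\<close> positive when
    \<open>n\<close> is 0.\<close>
  define C where "C = 4 * real (Suc n) / r"
  have "C > 0" using r by (simp add: C_def)
  moreover have "v \<in> closure (K ` cball 0 (C * norm v))" if v: "v \<in> range K" for v
  proof (cases "v = 0")
    case True
    then have "v = K 0" by (simp add: zero)
    then have "v \<in> K ` cball 0 (C * norm v)" using \<open>C > 0\<close> by (intro image_eqI[of _ _ 0]) auto
    then show ?thesis by (rule subsetD[OF closure_subset])
  next
    case False
    define s where "s = r / (2 * norm v)"
    have s: "s > 0" using r False by (simp add: s_def)
    obtain v' where v': "v = K v'" using v by (rule imageE)
    obtain y' where y': "y = K y'" using y by (rule imageE)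
    have "y + s *\<^sub>R v = K (y' + s *\<^sub>R v')" by (simp add: v' y' add scaleR)
    then have "y + s *\<^sub>R v \<in> range K" by (rule range_eqI)
    moreover have "dist y (y + s *\<^sub>R v) < r"
      using r False by (simp add: dist_norm s_def)
    ultimately have "y + s *\<^sub>R v \<in> ball y r \<inter> range K" by simp
    note * = subsetD[OF T(3) subsetD[OF r(2) this]] subsetD[OF T(3) T(2)]
    show ?thesis unfolding closure_approachable
    proof safe
      fix e :: real assume "e > 0"
      then have "s * e / 2 > 0" using s by simp
      with * obtain k l where "k \<in> K ` cball 0 (real n)" "dist k (y + s *\<^sub>R v) < s * e / 2"
        and "l \<in> K ` cball 0 (real n)" "dist l y < s * e / 2"
        unfolding closure_approachable by blast
      then obtain a b where a: "norm a \<le> real n" "dist (K a) (y + s *\<^sub>R v) < s * e / 2"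
        and b: "norm b \<le> real n" "dist (K b) y < s * e / 2"
        by (elim imageE) (simp add: mem_cball_0)
      \<comment> \<open>\<open>a\<close> nearly maps to \<open>y + s *\<^sub>R v\<close> and
        \<open>b\<close> nearly to \<open>y\<close>, so their difference nearly maps to
        \<open>s *\<^sub>R v\<close>. The two errors of \<open>s * e / 2\<close> add up to
        \<open>e\<close> after division by \<open>s\<close>.\<close>
      let ?c = "(1 / s) *\<^sub>R (a - b)"
      have "K ?c - v = (1 / s) *\<^sub>R ((K a - (y + s *\<^sub>R v)) - (K b - y))"
        using s by (simp add: scaleR diff algebra_simps)
      then have "dist (K ?c) v = (1 / s) * norm ((K a - (y + s *\<^sub>R v)) - (K b - y))"
        using s by (simp add: dist_norm)
      also have "\<dots> \<le> (1 / s) * (norm (K a - (y + s *\<^sub>R v)) + norm (K b - y))"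
        using s by (intro mult_left_mono norm_triangle_ineq4) auto
      also have "\<dots> < (1 / s) * (s * e / 2 + s * e / 2)"
        using s a b by (intro mult_strict_left_mono add_strict_mono) (auto simp: dist_norm)
      finally have "dist (K ?c) v < e" using s by simp
      moreover have "norm ?c \<le> C * norm v"
      proof -
        have "norm ?c = (1 / s) * norm (a - b)" using s by simp
        also have "\<dots> \<le> (1 / s) * (real (Suc n) + real (Suc n))"
          using s a b norm_triangle_ineq4[of a b] by (intro mult_left_mono) auto
        also have "\<dots> = C * norm v" using r False by (simp add: s_def C_def)
        finally show ?thesis .
      qed
      ultimately show "\<exists>z\<in>K ` cball 0 (C * norm v). dist z v < e" by (intro bexI[of _ "K ?c"] imageI) (simp_all only: mem_cball_0)
    qed
  qed
  ultimately show thesis by (rule that)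
qed

text \<open>Differences of partial sums of \<open>u\<close> are controlled by tails of \<open>a\<close>, so the partial sums form a Cauchy net.\<close>

lemma summable_on_dominated_squares:
  fixes u :: "'n \<Rightarrow> 'h::banach" and a :: "'n \<Rightarrow> real"
  assumes a: "a summable_on N" and "C \<ge> 0"
    and le: "\<And>F. finite F \<Longrightarrow> F \<subseteq> N \<Longrightarrow> (norm (sum u F))\<^sup>2 \<le> C * sum a F"
    and nonneg: "\<And>k. k \<in> N \<Longrightarrow> 0 \<le> a k"
  shows "u summable_on N"
proof -
  have \<open>\<exists>P. eventually P (finite_subsets_at_top N) \<and>
              (\<forall>F F'. P F \<and> P F' \<longrightarrow> dist (sum u F) (sum u F') < e)\<close> if \<open>e>0\<close> for e
  proof -
    \<comment> \<open>Chosen so that \<open>(C + 1) * d = (e / 2)\<^sup>2\<close>; the summand 1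
      keeps the quotient meaningful for \<open>C = 0\<close>.\<close>
    define d where "d = e\<^sup>2 / (4 * (C + 1))"
    have d: "d > 0" using that \<open>C \<ge> 0\<close> by (simp add: d_def)
    obtain F0 where F0: "finite F0" "F0 \<subseteq> N" "dist (sum a F0) (infsum a N) \<le> d / 2"
      using infsum_finite_approximation[OF a, of "d/2"] d by auto
    have close: "dist (sum u F) (sum u F0) < e / 2" if F: "finite F" "F0 \<subseteq> F" "F \<subseteq> N" for F
    proof -
      have "sum a F \<le> infsum a N" using a F nonneg by (intro finite_sum_le_infsum) auto
      moreover have "sum a F = sum a F0 + sum a (F - F0)"
        using F by (simp add: sum.subset_diff add.commute)
      ultimately have tail: "sum a (F - F0) \<le> d / 2" using F0(3) unfolding dist_real_def by linarith
      have "(dist (sum u F) (sum u F0))\<^sup>2 = (norm (sum u (F - F0)))\<^sup>2"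
        using F F0 by (simp add: dist_norm sum_diff)
      also have "\<dots> \<le> C * sum a (F - F0)" using F by (intro le) auto
      also have "\<dots> \<le> C * (d / 2)" using tail \<open>C \<ge> 0\<close> by (intro mult_left_mono)
      also have "\<dots> < (C + 1) * d" using d \<open>C \<ge> 0\<close> by (simp add: algebra_simps add_nonneg_pos)
      also have "\<dots> = (e / 2)\<^sup>2" using \<open>C \<ge> 0\<close> by (simp add: d_def field_simps power2_eq_square)
      finally show ?thesis using \<open>e > 0\<close> by (intro power2_less_imp_less[of _ "e / 2"]) linarith+
    qed
    have "eventually (\<lambda>F. finite F \<and> F0 \<subseteq> F \<and> F \<subseteq> N) (finite_subsets_at_top N)"
      using F0 by (auto simp: eventually_finite_subsets_at_top)
    moreover have "dist (sum u F) (sum u F') < e"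
      if "finite F \<and> F0 \<subseteq> F \<and> F \<subseteq> N" "finite F' \<and> F0 \<subseteq> F' \<and> F' \<subseteq> N" for F F'
      using close[of F] close[of F'] that dist_triangle2[of "sum u F" "sum u F'" "sum u F0"] by linarith
    ultimately show ?thesis
      by (intro exI[of _ "\<lambda>F. finite F \<and> F0 \<subseteq> F \<and> F \<subseteq> N"]) simp
  qed
  then have \<open>cauchy_filter (filtermap (sum u) (finite_subsets_at_top N))\<close>
    unfolding cauchy_filter_metric_filtermap by simp
  moreover have "complete (UNIV::'h set)" by (rule complete_UNIV)
  ultimately obtain L where \<open>(sum u \<longlongrightarrow> L) (finite_subsets_at_top N)\<close>
    using complete_uniform[where S=UNIV] by (force simp add: filterlim_def)
  then show ?thesis
    using summable_on_def has_sum_def by blast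
qed

text \<open>This turns an analysis bound into a synthesis bound: \<open>n\<close> will be the norm
  of a finite sum \<open>z\<close>, \<open>a\<close> the sizes of the coefficients that build it,
  and \<open>b\<close> the sizes of the analysis coefficients of \<open>z\<close>. After
  Cauchy-Schwarz a factor \<open>n\<^sup>2\<close> cancels.\<close>

lemma square_le_of_cauchy_schwarz:
  fixes a b :: "'n \<Rightarrow> real"
  assumes "n\<^sup>2 \<le> (\<Sum>k\<in>F. a k * b k)" and "(\<Sum>k\<in>F. (b k)\<^sup>2) \<le> B * n\<^sup>2" and "0 \<le> B"
  shows "n\<^sup>2 \<le> B * (\<Sum>k\<in>F. (a k)\<^sup>2)"
proof (cases "n = 0")
  case True
  then show ?thesis using \<open>0 \<le> B\<close> by (simp add: sum_nonneg)
next
  case False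
  have "n\<^sup>2 * n\<^sup>2 \<le> (\<Sum>k\<in>F. a k * b k)\<^sup>2"
    using mult_mono[OF assms(1) assms(1)] order_trans[OF _ assms(1)] by (simp add: power2_eq_square)
  also have "\<dots> \<le> (\<Sum>k\<in>F. (a k)\<^sup>2) * (\<Sum>k\<in>F. (b k)\<^sup>2)" by (rule Cauchy_Schwarz_ineq_sum)
  also have "\<dots> \<le> (\<Sum>k\<in>F. (a k)\<^sup>2) * (B * n\<^sup>2)"
    using assms(2) by (intro mult_left_mono sum_nonneg) auto
  finally have "n\<^sup>2 * n\<^sup>2 \<le> n\<^sup>2 * (B * (\<Sum>k\<in>F. (a k)\<^sup>2))" by (simp add: mult_ac)
  then show ?thesis by (rule mult_left_le_imp_le) (use False in simp)
qed

lemma norm_has_sum_square_le: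
  fixes u :: "'n \<Rightarrow> 'h::real_normed_vector"
  assumes u: "(u has_sum s) N" and a: "a summable_on N" and "0 \<le> B" and nonneg: "\<And>k. k \<in> N \<Longrightarrow> 0 \<le> a k"
    and le: "\<And>F. finite F \<Longrightarrow> F \<subseteq> N \<Longrightarrow> (norm (sum u F))\<^sup>2 \<le> B * sum a F"
  shows "(norm s)\<^sup>2 \<le> B * infsum a N"
proof (rule tendsto_upperbound)
  show "((\<lambda>F. (norm (sum u F))\<^sup>2) \<longlongrightarrow> (norm s)\<^sup>2) (finite_subsets_at_top N)"
    using u unfolding has_sum_def by (intro tendsto_intros)
  have "(norm (sum u F))\<^sup>2 \<le> B * infsum a N" if "finite F" "F \<subseteq> N" for F
  proof -
    have "sum a F \<le> infsum a N" using a that nonneg by (intro finite_sum_le_infsum) auto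
    then show ?thesis using le[OF that] \<open>0 \<le> B\<close> by (meson mult_left_mono order_trans)
  qed
  then show "\<forall>\<^sub>F F in finite_subsets_at_top N. (norm (sum u F))\<^sup>2 \<le> B * infsum a N"
    by (intro eventually_finite_subsets_at_top_weakI)
qed simp

section \<open>Scalars and the inner product\<close>

lemma conj_one [simp]: "conj (1::'k::real_or_complex) = 1"
  using mult_conj[of "1::'k"] by simp

lemma conj_of_real [simp]: "conj (of_real r :: 'k::real_or_complex) = of_real r"
  by (simp add: of_real_def conj_scaleR)

lemma conj_zero [simp]: "conj (0::'k::real_or_complex) = 0"
  using conj_of_real[of 0, where 'k='k] by simp

lemma mult_conj_of_real: "c * conj c = of_real ((norm c)\<^sup>2)"
  by (simp add: mult_conj of_real_def)

lemma norm_conj [simp]: "norm (conj c) = norm c"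
proof (cases "c = 0")
  case False
  have "norm c * norm (conj c) = norm c * norm c"
    using arg_cong[OF mult_conj_of_real[of c], of norm] by (simp add: norm_mult power2_eq_square)
  then show ?thesis using False by simp
qed simp

text \<open>Multiplying \<open>conj c\<close> by its conjugate and multiplying \<open>c\<close> by
  \<open>conj c\<close> give the same real number, because \<open>c\<close> and
  \<open>conj c\<close> have equal norms. The nonzero factor \<open>conj c\<close> then
  cancels.\<close>

lemma conj_conj [simp]: "conj (conj c) = c"
proof (cases "c = 0")
  case False
  then have "conj c \<noteq> 0" by (metis norm_conj norm_eq_zero)
  moreover have "conj c * conj (conj c) = conj c * c"
    using mult_conj_of_real[of c] mult_conj_of_real[of "conj c"] by (simp add: mult.commute)
  ultimately show ?thesis by simp
qed simp

lemma bounded_linear_conj: "bounded_linear conj"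
  by (rule bounded_linear_intro[of _ 1]) (simp_all add: conj_add conj_scaleR)

context hilbert_space
begin

lemma ip_scaleR_left: "ip (r *\<^sub>R x) y = of_real r * ip x y"
  by (metis smul_of_real ip_smul_left)

lemma ip_add_right: "ip x (y + z) = ip x y + ip x z"
  by (metis ip_commute ip_add_left conj_add)

lemma ip_smul_right: "ip x (smul c y) = conj c * ip x y"
  by (metis ip_commute ip_smul_left conj_mult)

lemma ip_scaleR_right: "ip x (r *\<^sub>R y) = of_real r * ip x y"
  by (metis smul_of_real ip_smul_right conj_of_real)

lemma ip_zero_left [simp]: "ip 0 y = 0"
  using ip_scaleR_left[of 0 0 y] by simp

lemma ip_zero_right [simp]: "ip x 0 = 0"
  using ip_scaleR_right[of x 0 0] by simp

lemma ip_minus_left: "ip (- x) y = - ip x y"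
  using ip_scaleR_left[of "-1" x y] by simp

lemma ip_diff_left: "ip (x - y) z = ip x z - ip y z"
  using ip_add_left[of x "-y" z] by (simp add: ip_minus_left)

lemma ip_sum_left: "ip (\<Sum>k\<in>F. u k) y = (\<Sum>k\<in>F. ip (u k) y)"
  by (induction F rule: infinite_finite_induct) (simp_all add: ip_add_left)

lemma ip_eq_zero_commute: "ip x y = 0 \<longleftrightarrow> ip y x = 0"
  by (metis ip_commute conj_zero)

text \<open>Both inner products induce the same norm, so expanding the squared norm of
  \<open>x + y\<close> twice compares them. The symmetrised \<open>ip\<close> serves as twice the
  real part in the abstract scalar field.\<close>

lemma ip_add_swap: "ip x y + ip y x = of_real (2 * inner x y)"
proof -
  have "(norm (x + y))\<^sup>2 = (norm x)\<^sup>2 + (norm y)\<^sup>2 + 2 * inner x y"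
    by (simp add: power2_norm_eq_inner inner_add inner_commute)
  moreover have "of_real ((norm (x + y))\<^sup>2)
      = of_real ((norm x)\<^sup>2) + of_real ((norm y)\<^sup>2) + (ip x y + ip y x)"
    unfolding ip_self[symmetric] by (simp add: ip_add_left ip_add_right)
  ultimately show ?thesis by simp
qed

lemma ip_eq_of_real_imp_inner:
  assumes "ip x y = of_real r"
  shows "inner x y = r"
proof -
  have "of_real (2 * r) = (of_real (2 * inner x y) :: 'k)"
    using assms ip_add_swap[of x y] ip_commute[of y x] by simp
  then show ?thesis unfolding of_real_eq_iff by simp
qed

text \<open>Multiplying \<open>x\<close> by the conjugate of \<open>ip x y\<close> makes the product
  real and nonnegative. This reduces Cauchy-Schwarz and orthogonality for \<open>ip\<close> to the
  corresponding facts for \<open>inner\<close>.\<close>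

lemma inner_smul_conj: "inner (smul (conj (ip x y)) x) y = (norm (ip x y))\<^sup>2"
  by (rule ip_eq_of_real_imp_inner)
    (simp add: ip_smul_left mult.commute mult_conj_of_real)

lemma norm_smul: "norm (smul c x) = norm c * norm x"
proof -
  have "of_real ((norm (smul c x))\<^sup>2) = c * (conj c * ip x x)"
    unfolding ip_self[symmetric] by (simp add: ip_smul_left ip_smul_right)
  also have "\<dots> = of_real ((norm c)\<^sup>2 * (norm x)\<^sup>2)"
    unfolding ip_self by (simp add: mult.assoc[symmetric] mult_conj_of_real)
  finally have "(norm (smul c x))\<^sup>2 = (norm c * norm x)\<^sup>2"
    unfolding of_real_eq_iff by (simp add: power_mult_distrib)
  then show ?thesis by simp
qed

lemma ip_bound: "norm (ip x y) \<le> norm x * norm y"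
proof (cases "ip x y = 0")
  case False
  have "(norm (ip x y))\<^sup>2 \<le> norm (smul (conj (ip x y)) x) * norm y"
    using inner_smul_conj[of x y] norm_cauchy_schwarz[of "smul (conj (ip x y)) x" y] by simp
  then have "norm (ip x y) * norm (ip x y) \<le> norm (ip x y) * (norm x * norm y)"
    by (simp add: norm_smul power2_eq_square mult.assoc)
  then show ?thesis using False by simp
qed simp

lemma ip_eq_zeroI:
  assumes "\<And>c. inner (smul c x) y = 0"
  shows "ip x y = 0"
  using inner_smul_conj[of x y] assms by simp

lemma ip_eqI:
  assumes "\<And>y. ip x y = ip z y"
  shows "x = z"
proof -
  have "ip (x - z) (x - z) = 0" using assms by (simp add: ip_diff_left)
  then have "of_real ((norm (x - z))\<^sup>2) = (0::'k)" by (simp only: ip_self)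
  then show ?thesis by simp
qed

lemma bounded_linear_ip_left: "bounded_linear (\<lambda>x. ip x y)"
  by (rule bounded_linear_intro[of _ "norm y"])
    (simp_all add: ip_add_left ip_scaleR_left ip_bound scaleR_conv_of_real)

lemma has_sum_ip_left:
  assumes "(u has_sum s) N"
  shows "((\<lambda>k. ip (u k) y) has_sum ip s y) N"
  using bounded_linear_ip_left assms by (rule has_sum_bounded_linear)

lemma bounded_operator_iff:
  "bounded_operator smul T \<longleftrightarrow>
     (\<forall>x y. T (x + y) = T x + T y) \<and> (\<forall>c x. T (smul c x) = smul c (T x)) \<and>
     (\<exists>C. \<forall>x. norm (T x) \<le> C * norm x)"
  unfolding bounded_operator_def Vector_Spaces.linear_iff using vector_space_axioms by blast

lemma bounded_operator_add: "bounded_operator smul T \<Longrightarrow> T (x + y) = T x + T y"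
  by (simp add: bounded_operator_iff)

lemma bounded_operator_smul: "bounded_operator smul T \<Longrightarrow> T (smul c x) = smul c (T x)"
  by (simp add: bounded_operator_iff)

lemma bounded_operator_imp_bounded_linear:
  assumes "bounded_operator smul T"
  shows "bounded_linear T"
proof -
  from assms obtain C where add: "\<And>x y. T (x + y) = T x + T y"
    and smul: "\<And>c x. T (smul c x) = smul c (T x)" and C: "\<And>x. norm (T x) \<le> C * norm x"
    unfolding bounded_operator_iff by blast
  show ?thesis
  proof (rule bounded_linear_intro[of _ C])
    show "T (r *\<^sub>R x) = r *\<^sub>R T x" for r x
      using smul[of "of_real r" x] by (simp add: smul_of_real)
  qed (use add C in \<open>auto simp: mult.commute\<close>)
qed

lemma closed_subspace_imp_real:
  assumes "closed_subspace smul V"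
  shows "Real_Vector_Spaces.subspace V"
  using assms unfolding closed_subspace_def Real_Vector_Spaces.subspace_def
  by (metis smul_of_real subspace_add subspace_scale subspace_0)

section \<open>Projections, adjoints and coercive operators\<close>

lemma orth_proj_eqI:
  assumes V: "closed_subspace smul V" and p: "p \<in> V" "\<And>v. v \<in> V \<Longrightarrow> ip (x - p) v = 0"
  shows "orth_proj ip V x = p"
  unfolding orth_proj_def
proof (rule the_equality)
  fix q assume q: "q \<in> V \<and> (\<forall>v\<in>V. ip (x - q) v = 0)"
  have "q - p \<in> V" using V p(1) q by (simp add: closed_subspace_def subspace_diff)
  then have "ip ((x - p) - (x - q)) (q - p) = 0"
    using p(2) q by (simp only: ip_diff_left) simp
  then have "ip (q - p) (q - p) = 0" by simp
  then show "q = p" by (simp add: ip_self)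
qed (use p in blast)

text \<open>The real orthogonal projection already works over the scalar field: \<open>V\<close>
  contains all multiples \<open>smul c v\<close>, so a residue that is orthogonal to
  \<open>V\<close> for \<open>inner\<close> is orthogonal for \<open>ip\<close> as well.\<close>

lemma
  assumes V: "closed_subspace smul V"
  shows orth_proj_in: "orth_proj ip V x \<in> V"
    and ip_diff_orth_proj: "v \<in> V \<Longrightarrow> ip (x - orth_proj ip V x) v = 0"
proof -
  obtain p where p: "p \<in> V" "\<And>v. v \<in> V \<Longrightarrow> inner (x - p) v = 0"
    using V closed_subspace_imp_real[OF V] orthogonal_projection_exists[of V x]
    unfolding closed_subspace_def by metis
  have orth: "ip (x - p) v = 0" if "v \<in> V" for v
  proof -
    have "smul c v \<in> V" for c
      using V that by (simp add: closed_subspace_def subspace_scale)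
    then have "ip v (x - p) = 0"
      using p(2) by (intro ip_eq_zeroI) (metis inner_commute)
    then show ?thesis by (simp add: ip_eq_zero_commute)
  qed
  have eq: "orth_proj ip V x = p" using V p(1) orth by (rule orth_proj_eqI)
  show "orth_proj ip V x \<in> V" using p(1) eq by simp
  show "v \<in> V \<Longrightarrow> ip (x - orth_proj ip V x) v = 0" using orth eq by simp
qed

context
  fixes V :: "'h set"
  assumes V: "closed_subspace smul V"
begin

lemma orth_proj_ident: "v \<in> V \<Longrightarrow> orth_proj ip V v = v"
  by (rule orth_proj_eqI[OF V]) simp_all

lemma ip_orth_proj_left: "v \<in> V \<Longrightarrow> ip (orth_proj ip V x) v = ip x v"
  using ip_diff_orth_proj[OF V, of v x] by (simp add: ip_diff_left)

lemma ip_orth_proj_right: "v \<in> V \<Longrightarrow> ip v (orth_proj ip V x) = ip v x"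
  using ip_orth_proj_left[of v x] by (metis ip_commute)

lemma ip_orth_proj_swap: "ip (orth_proj ip V x) y = ip x (orth_proj ip V y)"
  by (metis V ip_orth_proj_left ip_orth_proj_right orth_proj_in)

lemma norm_orth_proj_le: "norm (orth_proj ip V x) \<le> norm x"
proof -
  let ?p = "orth_proj ip V x"
  have "of_real ((norm ?p)\<^sup>2) = ip x ?p"
    using ip_orth_proj_left[OF orth_proj_in[OF V], of x x] by (simp add: ip_self)
  then have "norm (of_real ((norm ?p)\<^sup>2) :: 'k) \<le> norm x * norm ?p"
    using ip_bound by simp
  then have "norm ?p * norm ?p \<le> norm x * norm ?p"
    unfolding norm_of_real by (simp add: power2_eq_square)
  then show ?thesis by (cases "?p = 0") simp_all
qed

text \<open>Linearity is read off from symmetry: once the projection sits on the test vector, the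
  pairing is visibly linear in \<open>x\<close>. The frame operators below are treated in the same
  way.\<close>

lemma bounded_operator_orth_proj: "bounded_operator smul (orth_proj ip V)"
  unfolding bounded_operator_iff
proof (intro conjI allI)
  show "orth_proj ip V (x + y) = orth_proj ip V x + orth_proj ip V y" for x y
    by (rule ip_eqI) (simp add: ip_orth_proj_swap ip_add_left)
  show "orth_proj ip V (smul c x) = smul c (orth_proj ip V x)" for c x
    by (rule ip_eqI) (simp add: ip_orth_proj_swap ip_smul_left)
  show "\<exists>C. \<forall>x. norm (orth_proj ip V x) \<le> C * norm x"
    using norm_orth_proj_le by (intro exI[of _ 1]) simp
qed

end

section \<open>Adjoints of bounded operators\<close>

context
  fixes T :: "'h \<Rightarrow> 'h"
  assumes T: "bounded_operator smul T"
begin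

text \<open>Riesz representation for \<open>inner\<close> yields the candidate \<open>z\<close>; the
  work is to lift the identity from \<open>inner\<close> to \<open>ip\<close>. Existence and
  uniqueness together give meaning to the description operator in \<open>hadjoint\<close>.\<close>

lemma hadjoint: "ip (T x) y = ip x (hadjoint ip T y)"
proof -
  interpret bounded_linear T using T by (rule bounded_operator_imp_bounded_linear)
  have ex: "\<exists>z. \<forall>x. ip (T x) y = ip x z" for y
  proof -
    have "bounded_linear (\<lambda>x. inner (T x) y)"
      by (intro bounded_linear_compose[OF bounded_linear_inner_left bounded_linear_axioms])
    then obtain z where z: "\<And>x. inner (T x) y = inner x z"
      using riesz_representation by metis
    have "ip (T x) y = ip x z" for x
    proof -
      \<comment> \<open>\<open>c\<close> is the defect of the identity at \<open>x\<close>. Testing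
        at \<open>smul (conj c) x\<close> makes the defect the real number \<open>r\<close>, which
        is its own conjugate; as the symmetrised products agree by the choice of \<open>z\<close>,
        twice \<open>r\<close> vanishes.\<close>
      define c where "c = ip (T x) y - ip x z"
      let ?x = "smul (conj c) x"
      define r where "r = (norm c)\<^sup>2"
      have diff: "ip (T ?x) y - ip ?x z = of_real r"
        unfolding r_def using mult_conj_of_real[of c]
        by (simp add: bounded_operator_smul[OF T] ip_smul_left right_diff_distrib[symmetric] c_def[symmetric] mult.commute)
      moreover have "ip (T ?x) y + ip y (T ?x) = ip ?x z + ip z ?x"
        unfolding ip_add_swap z ..
      moreover have "ip y (T ?x) - ip z ?x = conj (ip (T ?x) y - ip ?x z)"
      proof -
        interpret conj: bounded_linear "conj :: 'k \<Rightarrow> 'k" by (rule bounded_linear_conj)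
        show ?thesis by (metis conj.diff ip_commute)
      qed
      ultimately have "of_real r + of_real r = (0::'k)"
        unfolding diff conj_of_real using diff by (simp add: algebra_simps)
      then have "of_real (2 * r) = (0::'k)" by simp
      then have "c = 0" unfolding of_real_eq_0_iff r_def by simp
      then show ?thesis by (simp add: c_def)
    qed
    then show ?thesis by blast
  qed
  then obtain T' where T': "\<And>x y. ip (T x) y = ip x (T' y)" by metis
  have "hadjoint ip T = T'"
    unfolding hadjoint_def
  proof (rule the_equality)
    fix T'' assume "\<forall>x y. ip (T x) y = ip x (T'' y)"
    then have "ip (T'' y) x = ip (T' y) x" for x y
      using T' by (metis ip_commute)
    then show "T'' = T'" by (intro ext ip_eqI)
  qed (use T' in blast)
  then show ?thesis using T' by simp
qed

lemma hadjoint_right: "ip y (T x) = ip (hadjoint ip T y) x"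
  by (metis hadjoint ip_commute)

lemma norm_hadjoint_le:
  assumes "\<And>x. norm (T x) \<le> C * norm x"
  shows "norm (hadjoint ip T y) \<le> C * norm y"
proof (cases "hadjoint ip T y = 0")
  case True
  moreover have "0 \<le> C * norm y" using order_trans[OF norm_ge_zero assms] .
  ultimately show ?thesis by simp
next
  case False
  let ?z = "hadjoint ip T y"
  have "norm (of_real ((norm ?z)\<^sup>2) :: 'k) \<le> norm (T ?z) * norm y"
    unfolding ip_self[symmetric] hadjoint[symmetric] by (rule ip_bound)
  also have "\<dots> \<le> C * norm ?z * norm y"
    using assms by (intro mult_right_mono) auto
  finally have "norm ?z * norm ?z \<le> norm ?z * (C * norm y)"
    unfolding norm_of_real by (simp add: power2_eq_square mult_ac)
  then show ?thesis using False by simp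
qed

lemma hadjoint_bounded:
  obtains C where "C > 0" and "\<And>y. norm (hadjoint ip T y) \<le> C * norm y"
proof -
  interpret bounded_linear T using T by (rule bounded_operator_imp_bounded_linear)
  from pos_bounded obtain C where "C > 0" "\<And>x. norm (T x) \<le> C * norm x"
    by (auto simp: mult.commute)
  then show thesis by (intro that norm_hadjoint_le)
qed

lemma closed_subspace_range: "closed (range T) \<Longrightarrow> closed_subspace smul (range T)"
  unfolding closed_subspace_def
proof (intro conjI subspaceI)
  interpret bounded_linear T using T by (rule bounded_operator_imp_bounded_linear)
  show "0 \<in> range T" by (metis zero rangeI)
  show "x \<in> range T \<Longrightarrow> y \<in> range T \<Longrightarrow> x + y \<in> range T" for x y
    by (metis (no_types, lifting) add rangeE rangeI)
  show "x \<in> range T \<Longrightarrow> smul c x \<in> range T" for c x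
    by (metis (no_types, lifting) bounded_operator_smul[OF T] rangeE rangeI)
qed

text \<open>If \<open>norm x\<close> is at most \<open>C * norm v\<close>, then pairing
  \<open>v\<close> with \<open>T x\<close> is the same as pairing the adjoint at \<open>v\<close>
  with \<open>x\<close>, hence at most \<open>C * norm v\<close> times the norm of that adjoint. The
  estimate defines a closed set of second arguments, so it persists in the limit
  \<open>T x = v\<close>.\<close>

lemma hadjoint_bounded_below_on_range:
  assumes "closed (range T)"
  obtains c where "c > 0" and "\<And>v. v \<in> range T \<Longrightarrow> c * norm v \<le> norm (hadjoint ip T v)"
proof -
  obtain C where C: "C > 0"
    and approx: "\<And>v. v \<in> range T \<Longrightarrow> v \<in> closure (T ` cball 0 (C * norm v))"
    using closed_range_approx[OF bounded_operator_imp_bounded_linear[OF T] assms] by metis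
  have "norm v \<le> C * norm (hadjoint ip T v)" if v: "v \<in> range T" for v
  proof (cases "v = 0")
    case True
    then show ?thesis using C by simp
  next
    case False
    let ?S = "{u. norm (ip v u) \<le> C * norm v * norm (hadjoint ip T v)}"
    have "bounded_linear (\<lambda>u. ip v u)"
      by (rule bounded_linear_intro[of _ "norm v"])
        (simp_all add: ip_add_right ip_scaleR_right scaleR_conv_of_real order_trans[OF ip_bound] mult.commute)
    then have "closed ?S"
      by (intro closed_Collect_le continuous_intros linear_continuous_on)
    moreover have "T ` cball 0 (C * norm v) \<subseteq> ?S"
    proof clarify
      fix x :: 'h assume "x \<in> cball 0 (C * norm v)"
      then have "norm (hadjoint ip T v) * norm x \<le> norm (hadjoint ip T v) * (C * norm v)"
        by (intro mult_left_mono) simp_all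
      then show "norm (ip v (T x)) \<le> C * norm v * norm (hadjoint ip T v)"
        unfolding hadjoint_right using ip_bound[of "hadjoint ip T v" x]
        by (simp add: mult_ac)
    qed
    ultimately have "v \<in> ?S"
      using approx[OF v] closure_minimal by blast
    then have "norm v * norm v \<le> norm v * (C * norm (hadjoint ip T v))"
      unfolding mem_Collect_eq ip_self norm_of_real by (simp add: power2_eq_square mult_ac)
    then show ?thesis using False by simp
  qed
  then have "(1 / C) * norm v \<le> norm (hadjoint ip T v)" if "v \<in> range T" for v
    using that C by (simp add: field_simps)
  then show thesis using C by (intro that[of "1 / C"]) auto
qed

section \<open>Operators that are coercive on a closed subspace\<close>

context
  fixes V :: "'h set" and c :: real
  assumes V: "closed_subspace smul V" and "c > 0"
    and coercive: "\<And>v. v \<in> V \<Longrightarrow> c * (norm v)\<^sup>2 \<le> inner (T v) v"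
begin

lemma coercive_bounded_below: "v \<in> V \<Longrightarrow> c * norm v \<le> norm (T v)"
proof (cases "v = 0")
  case False
  assume "v \<in> V"
  then have "c * (norm v)\<^sup>2 \<le> norm (T v) * norm v"
    using coercive norm_cauchy_schwarz order_trans by blast
  then show ?thesis using False by (simp add: power2_eq_square)
qed simp

lemma coercive_inj_on: "inj_on T V"
proof (rule inj_onI)
  interpret bounded_linear T using T by (rule bounded_operator_imp_bounded_linear)
  fix x y assume "x \<in> V" "y \<in> V" "T x = T y"
  then have "c * norm (x - y) \<le> 0"
    using coercive_bounded_below[of "x - y"] V
    by (simp add: closed_subspace_def subspace_diff diff)
  then show "x = y" using \<open>c > 0\<close> by (simp add: mult_le_0_iff)
qed

lemma coercive_closed_image: "closed_subspace smul (T ` V)"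
  unfolding closed_subspace_def
proof (intro conjI subspaceI)
  interpret bounded_linear T using T by (rule bounded_operator_imp_bounded_linear)
  have V': "subspace V" "closed V" using V by (simp_all add: closed_subspace_def)
  show "0 \<in> T ` V" using subspace_0[OF V'(1)] zero by (metis imageI)
  show "x \<in> T ` V \<Longrightarrow> y \<in> T ` V \<Longrightarrow> x + y \<in> T ` V" for x y
    using subspace_add[OF V'(1)] add by (metis (no_types, lifting) imageE imageI)
  show "x \<in> T ` V \<Longrightarrow> smul a x \<in> T ` V" for a x
    using subspace_scale[OF V'(1)] bounded_operator_smul[OF T]
    by (metis (no_types, lifting) imageE imageI)
  have "complete (T ` V)"
    using \<open>c > 0\<close> closed_subspace_imp_real[OF V] bounded_linear_axioms coercive_bounded_below V'(2)
    by (intro complete_isometric_image[of c]) (auto simp: complete_eq_closed)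
  then show "closed (T ` V)" by (rule complete_imp_closed)
qed

text \<open>The Lax-Milgram argument: the residue of \<open>x\<close> off the image lies in
  \<open>V\<close> again, so it is orthogonal to its own image under \<open>T\<close>, and
  coercivity makes it zero.\<close>

lemma coercive_surj:
  assumes "T ` V \<subseteq> V"
  shows "T ` V = V"
proof
  show "V \<subseteq> T ` V"
  proof
    fix x assume "x \<in> V"
    let ?p = "orth_proj ip (T ` V) x"
    have "?p \<in> T ` V" by (rule orth_proj_in[OF coercive_closed_image])
    then have w: "x - ?p \<in> V"
      using V assms \<open>x \<in> V\<close> by (auto simp: closed_subspace_def subspace_diff)
    then have "ip (x - ?p) (T (x - ?p)) = 0"
      by (intro ip_diff_orth_proj[OF coercive_closed_image]) blast
    then have "ip (T (x - ?p)) (x - ?p) = of_real 0"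
      using ip_eq_zero_commute by simp
    then have "inner (T (x - ?p)) (x - ?p) = 0" by (rule ip_eq_of_real_imp_inner)
    then have "c * (norm (x - ?p))\<^sup>2 \<le> 0" using coercive[OF w] by simp
    then have "x = ?p" using \<open>c > 0\<close> by (simp add: mult_le_0_iff)
    then show "x \<in> T ` V" using \<open>?p \<in> T ` V\<close> by simp
  qed
qed (rule assms)

end

end

section \<open>Bessel sequences and frames\<close>

lemma bounded_operator_hadjoint:
  assumes T: "bounded_operator smul T"
  shows "bounded_operator smul (hadjoint ip T)"
  unfolding bounded_operator_iff
proof (intro conjI allI)
  show "hadjoint ip T (x + y) = hadjoint ip T x + hadjoint ip T y" for x y
    by (rule ip_eqI) (simp add: hadjoint_right[OF T, symmetric] ip_add_left)
  show "hadjoint ip T (smul c x) = smul c (hadjoint ip T x)" for c x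
    by (rule ip_eqI) (simp add: hadjoint_right[OF T, symmetric] ip_smul_left)
  show "\<exists>C. \<forall>x. norm (hadjoint ip T x) \<le> C * norm x"
    using hadjoint_bounded[OF T] by metis
qed

lemma bessel_sequence_image:
  assumes T: "bounded_operator smul T" and g: "bessel_sequence ip N g"
  shows "bessel_sequence ip N (\<lambda>k. T (g k))"
proof -
  obtain B where B: "B > 0" "\<And>x. (\<lambda>k. (norm (ip x (g k)))\<^sup>2) summable_on N"
    "\<And>x. (\<Sum>\<^sub>\<infinity>k\<in>N. (norm (ip x (g k)))\<^sup>2) \<le> B * (norm x)\<^sup>2"
    using g unfolding bessel_sequence_def by blast
  obtain C where C: "C > 0" "\<And>y. norm (hadjoint ip T y) \<le> C * norm y"
    using hadjoint_bounded[OF T] by metis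
  have "(\<Sum>\<^sub>\<infinity>k\<in>N. (norm (ip (hadjoint ip T x) (g k)))\<^sup>2) \<le> (B * C\<^sup>2) * (norm x)\<^sup>2" for x
  proof -
    have "(norm (hadjoint ip T x))\<^sup>2 \<le> (C * norm x)\<^sup>2" using C by (intro power_mono) auto
    then have "B * (norm (hadjoint ip T x))\<^sup>2 \<le> B * (C * norm x)\<^sup>2"
      using B(1) by (intro mult_left_mono) auto
    then show ?thesis using B(3)[of "hadjoint ip T x"] by (simp add: power_mult_distrib mult_ac)
  qed
  then show ?thesis
    unfolding bessel_sequence_def hadjoint_right[OF T]
    using B(1,2) C(1) by (intro exI[of _ "B * C\<^sup>2"]) simp
qed

text \<open>Synthesis inherits the bound of analysis: a finite sum \<open>?z\<close> is paired with
  itself, and its analysis coefficients are controlled by the Bessel bound. Applied to tails, the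
  estimate gives convergence. \<open>B\<close> is quantified outside \<open>c\<close> because the
  bound has to be uniform in the coefficients.\<close>

lemma bessel_synthesis:
  assumes "bessel_sequence ip N g"
  shows "\<exists>B>0. \<forall>c. (\<lambda>k. (norm (c k))\<^sup>2) summable_on N \<longrightarrow>
    (\<lambda>k. smul (c k) (g k)) summable_on N \<and>
    (norm (\<Sum>\<^sub>\<infinity>k\<in>N. smul (c k) (g k)))\<^sup>2 \<le> B * (\<Sum>\<^sub>\<infinity>k\<in>N. (norm (c k))\<^sup>2)"
proof -
  obtain B where B: "B > 0" "\<And>x. (\<lambda>k. (norm (ip x (g k)))\<^sup>2) summable_on N"
    "\<And>x. (\<Sum>\<^sub>\<infinity>k\<in>N. (norm (ip x (g k)))\<^sup>2) \<le> B * (norm x)\<^sup>2"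
    using assms unfolding bessel_sequence_def by blast
  have le: "(norm (\<Sum>k\<in>F. smul (c k) (g k)))\<^sup>2 \<le> B * (\<Sum>k\<in>F. (norm (c k))\<^sup>2)"
    if F: "finite F" "F \<subseteq> N" for c F
  proof (rule square_le_of_cauchy_schwarz)
    let ?z = "\<Sum>k\<in>F. smul (c k) (g k)"
    have "(norm ?z)\<^sup>2 = norm (ip ?z ?z)" unfolding ip_self norm_of_real by simp
    also have "\<dots> = norm (\<Sum>k\<in>F. c k * ip (g k) ?z)"
      by (subst ip_sum_left) (simp add: ip_smul_left)
    also have "\<dots> \<le> (\<Sum>k\<in>F. norm (c k * ip (g k) ?z))" by (rule norm_sum)
    also have "\<dots> = (\<Sum>k\<in>F. norm (c k) * norm (ip ?z (g k)))"
      by (intro sum.cong refl) (metis ip_commute norm_conj norm_mult)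
    finally show "(norm ?z)\<^sup>2 \<le> (\<Sum>k\<in>F. norm (c k) * norm (ip ?z (g k)))" .
    have "(\<Sum>k\<in>F. (norm (ip ?z (g k)))\<^sup>2) \<le> (\<Sum>\<^sub>\<infinity>k\<in>N. (norm (ip ?z (g k)))\<^sup>2)"
      using B(2) F by (intro finite_sum_le_infsum) auto
    then show "(\<Sum>k\<in>F. (norm (ip ?z (g k)))\<^sup>2) \<le> B * (norm ?z)\<^sup>2"
      using B(3) order_trans by blast
  qed (use B in simp)
  show ?thesis
  proof (intro exI[of _ B] conjI allI impI)
    fix c :: "_ \<Rightarrow> 'k" assume c: "(\<lambda>k. (norm (c k))\<^sup>2) summable_on N"
    show s: "(\<lambda>k. smul (c k) (g k)) summable_on N"
      by (rule summable_on_dominated_squares[OF c _ le]) (use B in simp_all)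
    show "(norm (\<Sum>\<^sub>\<infinity>k\<in>N. smul (c k) (g k)))\<^sup>2 \<le> B * (\<Sum>\<^sub>\<infinity>k\<in>N. (norm (c k))\<^sup>2)"
      by (rule norm_has_sum_square_le[OF has_sum_infsum[OF s] c _ _ le]) (use B in simp_all)
  qed (use B in simp)
qed

lemma has_sum_conj: "(u has_sum s) N \<Longrightarrow> ((\<lambda>k. conj (u k)) has_sum conj s) N"
  by (rule has_sum_bounded_linear[OF bounded_linear_conj])

section \<open>Frames of a closed subspace and their canonical duals\<close>

context
  fixes V :: "'h set" and N :: "'n set" and g :: "'n \<Rightarrow> 'h" and A B :: real
  assumes V: "closed_subspace smul V" and frame: "frame_of ip V N g A B"
begin

lemma frame_elem: "j \<in> N \<Longrightarrow> g j \<in> V"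
  using frame by (simp add: frame_of_def)

lemma frame_bounds_pos: "0 < A" "0 < B"
  using frame by (auto simp: frame_of_def)

lemma frame_coeff: "j \<in> N \<Longrightarrow> ip x (g j) = ip (orth_proj ip V x) (g j)"
  by (simp add: ip_orth_proj_left[OF V frame_elem])

text \<open>The frame inequalities speak about vectors of \<open>V\<close> only. Since every
  \<open>g j\<close> lies in \<open>V\<close>, the coefficients of \<open>x\<close> are those of its
  projection, and this form of the bounds can be summed against the fusion frame inequality.\<close>

lemma
  shows summable_frame_coeffs: "(\<lambda>j. (norm (ip x (g j)))\<^sup>2) summable_on N"
    and frame_lower: "A * (norm (orth_proj ip V x))\<^sup>2 \<le> (\<Sum>\<^sub>\<infinity>j\<in>N. (norm (ip x (g j)))\<^sup>2)"
    and frame_upper: "(\<Sum>\<^sub>\<infinity>j\<in>N. (norm (ip x (g j)))\<^sup>2) \<le> B * (norm (orth_proj ip V x))\<^sup>2"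
proof -
  let ?p = "orth_proj ip V x"
  have "?p \<in> V" by (rule orth_proj_in[OF V])
  then have p: "(\<lambda>j. (norm (ip ?p (g j)))\<^sup>2) summable_on N"
    "A * (norm ?p)\<^sup>2 \<le> (\<Sum>\<^sub>\<infinity>j\<in>N. (norm (ip ?p (g j)))\<^sup>2)"
    "(\<Sum>\<^sub>\<infinity>j\<in>N. (norm (ip ?p (g j)))\<^sup>2) \<le> B * (norm ?p)\<^sup>2"
    using frame by (auto simp: frame_of_def)
  have s: "(\<lambda>j. (norm (ip x (g j)))\<^sup>2) summable_on N \<longleftrightarrow> (\<lambda>j. (norm (ip ?p (g j)))\<^sup>2) summable_on N"
    by (rule summable_on_cong) (simp add: frame_coeff[of _ x])
  have i: "(\<Sum>\<^sub>\<infinity>j\<in>N. (norm (ip x (g j)))\<^sup>2) = (\<Sum>\<^sub>\<infinity>j\<in>N. (norm (ip ?p (g j)))\<^sup>2)"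
    by (rule infsum_cong) (simp add: frame_coeff[of _ x])
  show "(\<lambda>j. (norm (ip x (g j)))\<^sup>2) summable_on N" unfolding s by (rule p)
  show "A * (norm ?p)\<^sup>2 \<le> (\<Sum>\<^sub>\<infinity>j\<in>N. (norm (ip x (g j)))\<^sup>2)" unfolding i by (rule p)
  show "(\<Sum>\<^sub>\<infinity>j\<in>N. (norm (ip x (g j)))\<^sup>2) \<le> B * (norm ?p)\<^sup>2" unfolding i by (rule p)
qed

lemma frame_upper_norm: "(\<Sum>\<^sub>\<infinity>j\<in>N. (norm (ip x (g j)))\<^sup>2) \<le> B * (norm x)\<^sup>2"
proof -
  have "B * (norm (orth_proj ip V x))\<^sup>2 \<le> B * (norm x)\<^sup>2"
    using frame_bounds_pos norm_orth_proj_le[OF V] by (intro mult_left_mono power_mono) auto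
  then show ?thesis using frame_upper[of x] by linarith
qed

lemma frame_bessel: "bessel_sequence ip N g"
  unfolding bessel_sequence_def
  using frame_bounds_pos summable_frame_coeffs frame_upper_norm by blast

lemma has_sum_frame_operator:
  "((\<lambda>j. smul (ip x (g j)) (g j)) has_sum frame_operator smul ip N g x) N"
  unfolding frame_operator_def
  proof (rule has_sum_infsum)
  obtain C where "\<forall>c. (\<lambda>k. (norm (c k))\<^sup>2) summable_on N \<longrightarrow>
    (\<lambda>k. smul (c k) (g k)) summable_on N \<and>
    (norm (\<Sum>\<^sub>\<infinity>k\<in>N. smul (c k) (g k)))\<^sup>2 \<le> C * (\<Sum>\<^sub>\<infinity>k\<in>N. (norm (c k))\<^sup>2)"
    using bessel_synthesis[OF frame_bessel] by (elim exE conjE)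
  from this[rule_format, OF summable_frame_coeffs]
  show "(\<lambda>j. smul (ip x (g j)) (g j)) summable_on N" by (rule conjunct1)
qed

lemma has_sum_ip_frame_operator:
  "((\<lambda>j. ip x (g j) * ip (g j) y) has_sum ip (frame_operator smul ip N g x) y) N"
  using has_sum_ip_left[OF has_sum_frame_operator[of x], of y] by (simp add: ip_smul_left)

lemma frame_operator_swap:
  "ip (frame_operator smul ip N g x) y = ip x (frame_operator smul ip N g y)"
proof -
  have "((\<lambda>j. conj (ip y (g j) * ip (g j) x)) has_sum conj (ip (frame_operator smul ip N g y) x)) N"
    by (rule has_sum_conj[OF has_sum_ip_frame_operator])
  then have "((\<lambda>j. ip x (g j) * ip (g j) y) has_sum ip x (frame_operator smul ip N g y)) N"
    by (simp add: conj_mult ip_commute[symmetric] mult.commute)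
  with has_sum_ip_frame_operator show ?thesis by (rule has_sum_unique)
qed

lemma bounded_operator_frame_operator: "bounded_operator smul (frame_operator smul ip N g)"
  unfolding bounded_operator_iff
proof (intro conjI allI)
  let ?S = "frame_operator smul ip N g"
  show "?S (x + y) = ?S x + ?S y" for x y
    by (rule ip_eqI) (simp add: frame_operator_swap ip_add_left)
  show "?S (smul c x) = smul c (?S x)" for c x
    by (rule ip_eqI) (simp add: frame_operator_swap ip_smul_left)
  obtain C where C: "C > 0" and synth: "\<forall>c. (\<lambda>k. (norm (c k))\<^sup>2) summable_on N \<longrightarrow>
    (\<lambda>k. smul (c k) (g k)) summable_on N \<and>
    (norm (\<Sum>\<^sub>\<infinity>k\<in>N. smul (c k) (g k)))\<^sup>2 \<le> C * (\<Sum>\<^sub>\<infinity>k\<in>N. (norm (c k))\<^sup>2)"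
    using bessel_synthesis[OF frame_bessel] by (elim exE conjE)
  \<comment> \<open>The frame operator is analysis, with bound \<open>B\<close>, followed by
    synthesis, with bound \<open>C\<close>; both bounds concern squared norms, hence the
    root.\<close>
  have "norm (?S x) \<le> sqrt (C * B) * norm x" for x
  proof (rule power2_le_imp_le)
    have "(norm (?S x))\<^sup>2 \<le> C * (\<Sum>\<^sub>\<infinity>k\<in>N. (norm (ip x (g k)))\<^sup>2)"
      unfolding frame_operator_def
      by (rule conjunct2[OF synth[rule_format, OF summable_frame_coeffs]])
    also have "\<dots> \<le> C * (B * (norm x)\<^sup>2)"
      using C frame_upper_norm by (intro mult_left_mono) auto
    finally show "(norm (?S x))\<^sup>2 \<le> (sqrt (C * B) * norm x)\<^sup>2"
      using C frame_bounds_pos by (simp add: power_mult_distrib mult.assoc)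
  qed (use C frame_bounds_pos in simp)
  then show "\<exists>C. \<forall>x. norm (?S x) \<le> C * norm x" by blast
qed

text \<open>Every pairing with the vector sees only the projection of the test vector, because the
  \<open>g j\<close> lie in \<open>V\<close>. So projecting the vector does not change it.\<close>

lemma frame_operator_in: "frame_operator smul ip N g x \<in> V"
proof -
  let ?S = "frame_operator smul ip N g"
  have "ip (?S x) (orth_proj ip V y) = ip (?S x) y" for y
  proof (rule has_sum_unique)
    show "((\<lambda>j. ip x (g j) * ip (g j) y) has_sum ip (?S x) y) N"
      by (rule has_sum_ip_frame_operator)
    have "((\<lambda>j. ip x (g j) * ip (g j) (orth_proj ip V y)) has_sum ip (?S x) (orth_proj ip V y)) N"
      by (rule has_sum_ip_frame_operator)
    then show "((\<lambda>j. ip x (g j) * ip (g j) y) has_sum ip (?S x) (orth_proj ip V y)) N"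
      by (rule has_sum_cong[THEN iffD1, rotated]) (simp add: ip_orth_proj_right[OF V frame_elem])
  qed
  then have "orth_proj ip V (?S x) = ?S x"
    by (intro ip_eqI) (simp add: ip_orth_proj_swap[OF V])
  then show ?thesis using orth_proj_in[OF V] by metis
qed

lemma inner_frame_operator:
  "inner (frame_operator smul ip N g x) x = (\<Sum>\<^sub>\<infinity>j\<in>N. (norm (ip x (g j)))\<^sup>2)"
proof (rule ip_eq_of_real_imp_inner)
  have "((\<lambda>j. of_real ((norm (ip x (g j)))\<^sup>2) :: 'k) has_sum
      of_real (\<Sum>\<^sub>\<infinity>j\<in>N. (norm (ip x (g j)))\<^sup>2)) N"
    by (rule has_sum_bounded_linear[OF bounded_linear_of_real has_sum_infsum[OF summable_frame_coeffs]])
  then have "((\<lambda>j. ip x (g j) * ip (g j) x) has_sum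
      of_real (\<Sum>\<^sub>\<infinity>j\<in>N. (norm (ip x (g j)))\<^sup>2)) N"
    unfolding mult_conj_of_real[symmetric] ip_commute[symmetric] .
  with has_sum_ip_frame_operator
  show "ip (frame_operator smul ip N g x) x = of_real (\<Sum>\<^sub>\<infinity>j\<in>N. (norm (ip x (g j)))\<^sup>2)"
    by (rule has_sum_unique)
qed

lemma frame_operator_coercive:
  "v \<in> V \<Longrightarrow> A * (norm v)\<^sup>2 \<le> inner (frame_operator smul ip N g v) v"
  using frame_lower[of v] by (simp add: inner_frame_operator orth_proj_ident[OF V])

text \<open>Surjectivity makes the \<open>inv_into\<close> in \<open>canonical_dual\<close> select
  genuine preimages of the frame vectors.\<close>

lemma frame_operator_image: "frame_operator smul ip N g ` V = V"
  using coercive_surj[OF bounded_operator_frame_operator V frame_bounds_pos(1) frame_operator_coercive]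
    frame_operator_in by blast

lemma
  assumes "j \<in> N"
  shows canonical_dual_in: "canonical_dual smul ip V N g j \<in> V"
    and frame_operator_canonical_dual: "frame_operator smul ip N g (canonical_dual smul ip V N g j) = g j"
proof -
  have "g j \<in> frame_operator smul ip N g ` V"
    using frame_elem[OF assms] frame_operator_image by simp
  then show "canonical_dual smul ip V N g j \<in> V"
    "frame_operator smul ip N g (canonical_dual smul ip V N g j) = g j"
    unfolding canonical_dual_def by (rule inv_into_into, rule f_inv_into_f)
qed

text \<open>Symmetry moves the inverse frame operator from the dual vector onto \<open>y\<close>.
  Sums over the dual frame thereby become sums over the frame itself, taken at
  \<open>w\<close>.\<close>

lemma canonical_dual_coeff:
  assumes "j \<in> N" and "frame_operator smul ip N g w = orth_proj ip V y"
  shows "ip y (canonical_dual smul ip V N g j) = ip w (g j)"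
proof -
  let ?d = "canonical_dual smul ip V N g j"
  have "ip y ?d = ip (frame_operator smul ip N g w) ?d"
    using ip_orth_proj_left[OF V canonical_dual_in[OF assms(1)], of y] assms(2) by simp
  also have "\<dots> = ip w (g j)"
    by (simp only: frame_operator_swap frame_operator_canonical_dual[OF assms(1)])
  finally show ?thesis .
qed

text \<open>With \<open>w\<close> a preimage of the projection of \<open>y\<close>, this is the
  series of the frame operator at \<open>x\<close> paired with \<open>w\<close>. Reconstruction is
  stated weakly, against a test vector, which is all that the later dualities use.\<close>

lemma has_sum_frame_dual:
  "((\<lambda>j. ip x (g j) * ip (canonical_dual smul ip V N g j) y) has_sum ip (orth_proj ip V x) y) N"
proof -
  obtain w where w: "frame_operator smul ip N g w = orth_proj ip V y"
    using frame_operator_image orth_proj_in[OF V, of y] by (metis imageE)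
  have "((\<lambda>j. ip x (g j) * ip (g j) w) has_sum ip (orth_proj ip V x) y) N"
    using has_sum_ip_frame_operator[of x w]
    by (simp only: frame_operator_swap[of x] w ip_orth_proj_swap[OF V])
  then show ?thesis
    by (rule has_sum_cong[THEN iffD1, rotated]) (simp only: canonical_dual_coeff[OF _ w] ip_commute[of _ y] ip_commute[of _ w])
qed

lemma has_sum_dual_frame:
  "((\<lambda>j. ip x (canonical_dual smul ip V N g j) * ip (g j) y) has_sum ip (orth_proj ip V x) y) N"
  using has_sum_conj[OF has_sum_frame_dual[of y x]] ip_orth_proj_swap[OF V, of x y]
  by (simp only: conj_mult ip_commute[symmetric] mult.commute)

text \<open>For a preimage \<open>w\<close> of the projection \<open>?p\<close> in \<open>V\<close>,
  the sum equals \<open>inner ?p w\<close>. Coercivity bounds \<open>norm w\<close> by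
  \<open>norm ?p / A\<close>, which is where the constant \<open>1 / A\<close> comes from.\<close>

lemma
  shows summable_canonical_dual_coeffs:
      "(\<lambda>j. (norm (ip x (canonical_dual smul ip V N g j)))\<^sup>2) summable_on N"
    and canonical_dual_upper: "(\<Sum>\<^sub>\<infinity>j\<in>N. (norm (ip x (canonical_dual smul ip V N g j)))\<^sup>2)
      \<le> (1 / A) * (norm (orth_proj ip V x))\<^sup>2"
proof -
  let ?S = "frame_operator smul ip N g" and ?p = "orth_proj ip V x"
  obtain w where w: "w \<in> V" "?S w = ?p"
    using frame_operator_image orth_proj_in[OF V, of x] by (metis imageE)
  note coeff = canonical_dual_coeff[OF _ w(2)]
  show "(\<lambda>j. (norm (ip x (canonical_dual smul ip V N g j)))\<^sup>2) summable_on N"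
    using summable_frame_coeffs[of w]
    by (rule summable_on_cong[THEN iffD1, rotated]) (simp add: coeff)
  have "(\<Sum>\<^sub>\<infinity>j\<in>N. (norm (ip x (canonical_dual smul ip V N g j)))\<^sup>2) = (\<Sum>\<^sub>\<infinity>j\<in>N. (norm (ip w (g j)))\<^sup>2)"
    by (rule infsum_cong) (simp add: coeff)
  also have "\<dots> = inner ?p w" using inner_frame_operator[of w] w by simp
  also have "\<dots> \<le> norm ?p * norm w" by (rule norm_cauchy_schwarz)
  also have "\<dots> \<le> norm ?p * (norm ?p / A)"
  proof (rule mult_left_mono)
    have "A * norm w \<le> norm (?S w)"
      using bounded_operator_frame_operator V frame_bounds_pos(1) frame_operator_coercive w(1)
      by (rule coercive_bounded_below)
    then show "norm w \<le> norm ?p / A" using w frame_bounds_pos by (simp add: field_simps)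
  qed simp
  finally show "(\<Sum>\<^sub>\<infinity>j\<in>N. (norm (ip x (canonical_dual smul ip V N g j)))\<^sup>2) \<le> (1 / A) * (norm ?p)\<^sup>2"
    by (simp add: power2_eq_square)
qed

end

section \<open>Criteria for K-frames and K-duals\<close>

context
  fixes K :: "'h \<Rightarrow> 'h" and N :: "'n set" and g h :: "'n \<Rightarrow> 'h"
  assumes K: "bounded_operator smul K"
    and h: "bessel_sequence ip N h"
begin

text \<open>The upper bound is the Bessel bound of \<open>g\<close>; the lower constant
  \<open>1 / C\<close> is the inverse synthesis bound of \<open>h\<close>. The premise
  \<open>dual\<close> only identifies the value of a convergent series: convergence itself comes
  from \<open>bessel_synthesis\<close>.\<close>

lemma K_frame_of_duality:
  assumes g: "bessel_sequence ip N g"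
    and dual: "\<And>x y z. ((\<lambda>k. ip x (h k) * ip (g k) y) has_sum z) N \<Longrightarrow> z = ip (K x) y"
  shows "K_frame ip K N g"
proof -
  obtain B where B: "B > 0" "\<And>x. (\<lambda>k. (norm (ip x (g k)))\<^sup>2) summable_on N"
    "\<And>x. (\<Sum>\<^sub>\<infinity>k\<in>N. (norm (ip x (g k)))\<^sup>2) \<le> B * (norm x)\<^sup>2"
    using g unfolding bessel_sequence_def by blast
  obtain C where C: "C > 0" and synth: "\<forall>c. (\<lambda>k. (norm (c k))\<^sup>2) summable_on N \<longrightarrow>
    (\<lambda>k. smul (c k) (h k)) summable_on N \<and>
    (norm (\<Sum>\<^sub>\<infinity>k\<in>N. smul (c k) (h k)))\<^sup>2 \<le> C * (\<Sum>\<^sub>\<infinity>k\<in>N. (norm (c k))\<^sup>2)"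
    using bessel_synthesis[OF h] by (elim exE conjE)
  have lower: "(1 / C) * (norm (hadjoint ip K y))\<^sup>2 \<le> (\<Sum>\<^sub>\<infinity>k\<in>N. (norm (ip y (g k)))\<^sup>2)" for y
  proof -
    let ?u = "\<Sum>\<^sub>\<infinity>k\<in>N. smul (ip y (g k)) (h k)"
    note syn = synth[rule_format, OF B(2)[of y]]
    have "ip ?u x = ip (hadjoint ip K y) x" for x
    proof -
      have "((\<lambda>k. ip (smul (ip y (g k)) (h k)) x) has_sum ip ?u x) N"
        by (intro has_sum_ip_left has_sum_infsum conjunct1[OF syn])
      from has_sum_conj[OF this]
      have "((\<lambda>k. ip x (h k) * ip (g k) y) has_sum ip x ?u) N"
        by (simp only: ip_smul_left conj_mult ip_commute[symmetric] mult.commute)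
      then have "ip x ?u = ip (K x) y" by (rule dual)
      then show ?thesis by (metis hadjoint[OF K] ip_commute)
    qed
    then have "?u = hadjoint ip K y" by (rule ip_eqI)
    then show ?thesis using conjunct2[OF syn] C by (simp add: field_simps)
  qed
  have "\<forall>f. (\<lambda>k. (norm (ip f (g k)))\<^sup>2) summable_on N \<and>
        (1 / C) * (norm (hadjoint ip K f))\<^sup>2 \<le> (\<Sum>\<^sub>\<infinity>k\<in>N. (norm (ip f (g k)))\<^sup>2) \<and>
        (\<Sum>\<^sub>\<infinity>k\<in>N. (norm (ip f (g k)))\<^sup>2) \<le> B * (norm f)\<^sup>2"
    using B(2,3) lower by blast
  then show ?thesis
    unfolding K_frame_def using C B(1) by (metis zero_less_divide_1_iff)
qed

text \<open>The projection onto the range moves onto the test vector, so the duality has to be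
  checked for \<open>y\<close> in the range only. Convergence in norm comes from the Bessel property
  of the projected family.\<close>

lemma K_dualI:
  assumes cl: "closed (range K)" and g: "K_frame ip K N g"
    and dual: "\<And>x y z. y \<in> range K \<Longrightarrow> ((\<lambda>k. ip x (h k) * ip (g k) y) has_sum z) N \<Longrightarrow> z = ip (K x) y"
  shows "K_dual smul ip K N h g"
  unfolding K_dual_def
proof (intro conjI allI g h)
  fix x
  note V = closed_subspace_range[OF K cl]
  let ?P = "orth_proj ip (range K)"
  have "bessel_sequence ip N g"
    using g unfolding K_frame_def bessel_sequence_def by blast
  then have "bessel_sequence ip N (\<lambda>k. ?P (g k))"
    by (rule bessel_sequence_image[OF bounded_operator_orth_proj[OF V]])
  from bessel_synthesis[OF this] obtain C where synth: "\<forall>c. (\<lambda>k. (norm (c k))\<^sup>2) summable_on N \<longrightarrow>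
    (\<lambda>k. smul (c k) (?P (g k))) summable_on N \<and>
    (norm (\<Sum>\<^sub>\<infinity>k\<in>N. smul (c k) (?P (g k))))\<^sup>2 \<le> C * (\<Sum>\<^sub>\<infinity>k\<in>N. (norm (c k))\<^sup>2)"
    by (elim exE conjE)
  have "(\<lambda>k. (norm (ip x (h k)))\<^sup>2) summable_on N"
    using h unfolding bessel_sequence_def by blast
  from synth[rule_format, OF this]
  have sum: "((\<lambda>k. smul (ip x (h k)) (?P (g k))) has_sum (\<Sum>\<^sub>\<infinity>k\<in>N. smul (ip x (h k)) (?P (g k)))) N"
    (is "(_ has_sum ?s) N") by (intro has_sum_infsum) (rule conjunct1)
  have "ip ?s y = ip (K x) y" for y
  proof -
    have "((\<lambda>k. ip x (h k) * ip (g k) (?P y)) has_sum ip ?s y) N"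
      using has_sum_ip_left[OF sum, of y] by (simp only: ip_smul_left ip_orth_proj_swap[OF V])
    then have "ip ?s y = ip (K x) (?P y)"
      by (rule dual[OF orth_proj_in[OF V]])
    then show ?thesis using ip_orth_proj_right[OF V, of "K x"] by simp
  qed
  then have "?s = K x" by (rule ip_eqI)
  then show "((\<lambda>k. smul (ip x (h k)) (?P (g k))) has_sum K x) N" using sum by simp
qed

end

section \<open>Fusion frames\<close>

context
  fixes K :: "'h \<Rightarrow> 'h" and I :: "'i set" and W :: "'i \<Rightarrow> 'h set" and \<omega> :: "'i \<Rightarrow> real"
  assumes fusion: "K_fusion_frame smul ip K I W \<omega>"
begin

lemma fusion_subspace: "i \<in> I \<Longrightarrow> closed_subspace smul (W i)"
  and fusion_weight_pos: "i \<in> I \<Longrightarrow> 0 < \<omega> i"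
  using fusion by (simp_all add: K_fusion_frame_def)

lemma summable_fusion: "(\<lambda>i. (\<omega> i)\<^sup>2 * (norm (orth_proj ip (W i) x))\<^sup>2) summable_on I"
  using fusion unfolding K_fusion_frame_def by blast

lemma fusion_upper:
  "\<exists>B>0. \<forall>x. (\<Sum>\<^sub>\<infinity>i\<in>I. (\<omega> i)\<^sup>2 * (norm (orth_proj ip (W i) x))\<^sup>2) \<le> B * (norm x)\<^sup>2"
proof -
  from fusion obtain A B where "0 < A" "A \<le> B"
    "\<forall>x. (\<Sum>\<^sub>\<infinity>i\<in>I. (\<omega> i)\<^sup>2 * (norm (orth_proj ip (W i) x))\<^sup>2) \<le> B * (norm x)\<^sup>2"
    unfolding K_fusion_frame_def by blast
  then show ?thesis by (intro exI[of _ B] conjI) linarith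
qed

lemma fusion_lower:
  "\<exists>A>0. \<forall>x. A * (norm (hadjoint ip K x))\<^sup>2
    \<le> (\<Sum>\<^sub>\<infinity>i\<in>I. (\<omega> i)\<^sup>2 * (norm (orth_proj ip (W i) x))\<^sup>2)"
  using fusion unfolding K_fusion_frame_def by blast

text \<open>The operator-valued form of the synthesis estimate:
  \<open>\<omega> i * norm (?P i x)\<close> plays the part of the synthesis coefficients and
  \<open>\<omega> i * norm (?P i ?z)\<close> that of the analysis coefficients of the sum
  \<open>?z\<close>.\<close>

lemma fusion_partial_sum:
  assumes B: "B > 0" "\<forall>x. (\<Sum>\<^sub>\<infinity>i\<in>I. (\<omega> i)\<^sup>2 * (norm (orth_proj ip (W i) x))\<^sup>2) \<le> B * (norm x)\<^sup>2"
    and F: "finite F" "F \<subseteq> I"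
  shows "(norm (\<Sum>i\<in>F. (\<omega> i)\<^sup>2 *\<^sub>R orth_proj ip (W i) x))\<^sup>2
      \<le> B * (\<Sum>i\<in>F. (\<omega> i)\<^sup>2 * (norm (orth_proj ip (W i) x))\<^sup>2)" (is "(norm ?z)\<^sup>2 \<le> _")
proof -
  let ?P = "\<lambda>i. orth_proj ip (W i)"
  have "(norm ?z)\<^sup>2 \<le> B * (\<Sum>i\<in>F. (\<omega> i * norm (?P i x))\<^sup>2)"
  proof (rule square_le_of_cauchy_schwarz)
    have "(norm ?z)\<^sup>2 = norm (ip ?z ?z)" unfolding ip_self norm_of_real by simp
    also have "\<dots> = norm (\<Sum>i\<in>F. of_real ((\<omega> i)\<^sup>2) * ip (?P i x) ?z)"
      by (subst ip_sum_left) (simp only: ip_scaleR_left)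
    also have "\<dots> \<le> (\<Sum>i\<in>F. norm (of_real ((\<omega> i)\<^sup>2) * ip (?P i x) ?z))" by (rule norm_sum)
    also have "\<dots> \<le> (\<Sum>i\<in>F. (\<omega> i * norm (?P i x)) * (\<omega> i * norm (?P i ?z)))"
    proof (rule sum_mono)
      fix i assume "i \<in> F"
      then have W: "closed_subspace smul (W i)" using F fusion_subspace by blast
      have "ip (?P i x) ?z = ip (?P i x) (?P i ?z)"
        by (rule ip_orth_proj_right[OF W orth_proj_in[OF W], symmetric])
      then have "norm (of_real ((\<omega> i)\<^sup>2) * ip (?P i x) ?z) = (\<omega> i)\<^sup>2 * norm (ip (?P i x) (?P i ?z))"
        unfolding norm_mult norm_of_real by simp
      also have "\<dots> \<le> (\<omega> i)\<^sup>2 * (norm (?P i x) * norm (?P i ?z))"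
        by (intro mult_left_mono ip_bound) simp
      finally show "norm (of_real ((\<omega> i)\<^sup>2) * ip (?P i x) ?z)
          \<le> (\<omega> i * norm (?P i x)) * (\<omega> i * norm (?P i ?z))"
        by (simp only: power2_eq_square mult_ac)
    qed
    finally show "(norm ?z)\<^sup>2 \<le> (\<Sum>i\<in>F. (\<omega> i * norm (?P i x)) * (\<omega> i * norm (?P i ?z)))" .
    have "(\<Sum>i\<in>F. (\<omega> i)\<^sup>2 * (norm (?P i ?z))\<^sup>2) \<le> (\<Sum>\<^sub>\<infinity>i\<in>I. (\<omega> i)\<^sup>2 * (norm (?P i ?z))\<^sup>2)"
      by (rule finite_sum_le_infsum[OF summable_fusion F]) simp
    then show "(\<Sum>i\<in>F. (\<omega> i * norm (?P i ?z))\<^sup>2) \<le> B * (norm ?z)\<^sup>2"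
      unfolding power_mult_distrib using B(2)[rule_format, of ?z] by linarith
  qed (use B in simp)
  then show ?thesis by (simp only: power_mult_distrib)
qed

lemma has_sum_fusion_frame_operator:
  "((\<lambda>i. (\<omega> i)\<^sup>2 *\<^sub>R orth_proj ip (W i) x) has_sum fusion_frame_operator ip I W \<omega> x) I"
  unfolding fusion_frame_operator_def
proof (rule has_sum_infsum)
  obtain B where B: "B > 0"
    "\<forall>x. (\<Sum>\<^sub>\<infinity>i\<in>I. (\<omega> i)\<^sup>2 * (norm (orth_proj ip (W i) x))\<^sup>2) \<le> B * (norm x)\<^sup>2"
    using fusion_upper by (elim exE conjE)
  show "(\<lambda>i. (\<omega> i)\<^sup>2 *\<^sub>R orth_proj ip (W i) x) summable_on I"
    by (rule summable_on_dominated_squares[OF summable_fusion _ fusion_partial_sum[OF B]]) (use B(1) in simp_all)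
qed

lemma has_sum_ip_fusion_frame_operator:
  "((\<lambda>i. of_real ((\<omega> i)\<^sup>2) * ip (orth_proj ip (W i) x) y) has_sum
     ip (fusion_frame_operator ip I W \<omega> x) y) I"
  using has_sum_ip_left[OF has_sum_fusion_frame_operator[of x], of y] by (simp only: ip_scaleR_left)

lemma fusion_frame_operator_swap:
  "ip (fusion_frame_operator ip I W \<omega> x) y = ip x (fusion_frame_operator ip I W \<omega> y)"
proof (rule has_sum_unique)
  let ?S = "fusion_frame_operator ip I W \<omega>"
  show "((\<lambda>i. of_real ((\<omega> i)\<^sup>2) * ip (orth_proj ip (W i) x) y) has_sum ip (?S x) y) I"
    by (rule has_sum_ip_fusion_frame_operator)
  have "((\<lambda>i. of_real ((\<omega> i)\<^sup>2) * ip x (orth_proj ip (W i) y)) has_sum ip x (?S y)) I"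
    using has_sum_conj[OF has_sum_ip_fusion_frame_operator[of y x]]
    by (simp only: conj_mult conj_of_real ip_commute[symmetric])
  then show "((\<lambda>i. of_real ((\<omega> i)\<^sup>2) * ip (orth_proj ip (W i) x) y) has_sum ip x (?S y)) I"
    by (rule has_sum_cong[THEN iffD1, rotated]) (simp only: ip_orth_proj_swap[OF fusion_subspace])
qed

lemma bounded_operator_fusion_frame_operator:
  "bounded_operator smul (fusion_frame_operator ip I W \<omega>)"
  unfolding bounded_operator_iff
proof (intro conjI allI)
  let ?S = "fusion_frame_operator ip I W \<omega>"
  show "?S (x + y) = ?S x + ?S y" for x y
    by (rule ip_eqI) (simp only: fusion_frame_operator_swap ip_add_left)
  show "?S (smul c x) = smul c (?S x)" for c x
    by (rule ip_eqI) (simp only: fusion_frame_operator_swap ip_smul_left)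
  obtain B where B: "B > 0"
    "\<forall>x. (\<Sum>\<^sub>\<infinity>i\<in>I. (\<omega> i)\<^sup>2 * (norm (orth_proj ip (W i) x))\<^sup>2) \<le> B * (norm x)\<^sup>2"
    using fusion_upper by (elim exE conjE)
  have "norm (?S x) \<le> B * norm x" for x
  proof (rule power2_le_imp_le)
    have "(norm (?S x))\<^sup>2 \<le> B * (\<Sum>\<^sub>\<infinity>i\<in>I. (\<omega> i)\<^sup>2 * (norm (orth_proj ip (W i) x))\<^sup>2)"
      by (rule norm_has_sum_square_le[OF has_sum_fusion_frame_operator summable_fusion _ _ fusion_partial_sum[OF B]])
        (use B(1) in simp_all)
    also have "\<dots> \<le> B * (B * (norm x)\<^sup>2)"
      using B by (intro mult_left_mono) auto
    finally show "(norm (?S x))\<^sup>2 \<le> (B * norm x)\<^sup>2" by (simp only: power2_eq_square mult_ac)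
  qed (use B(1) in simp)
  then show "\<exists>C. \<forall>x. norm (?S x) \<le> C * norm x" by blast
qed

lemma inner_fusion_frame_operator:
  "inner (fusion_frame_operator ip I W \<omega> x) x = (\<Sum>\<^sub>\<infinity>i\<in>I. (\<omega> i)\<^sup>2 * (norm (orth_proj ip (W i) x))\<^sup>2)"
    (is "_ = ?r")
proof (rule ip_eq_of_real_imp_inner)
  have "((\<lambda>i. of_real ((\<omega> i)\<^sup>2 * (norm (orth_proj ip (W i) x))\<^sup>2) :: 'k) has_sum of_real ?r) I"
    by (rule has_sum_bounded_linear[OF bounded_linear_of_real has_sum_infsum[OF summable_fusion]])
  then have "((\<lambda>i. of_real ((\<omega> i)\<^sup>2) * ip (orth_proj ip (W i) x) x) has_sum of_real ?r) I"
  proof (rule has_sum_cong[THEN iffD1, rotated])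
    fix i assume "i \<in> I"
    note W = fusion_subspace[OF this]
    have "of_real ((norm (orth_proj ip (W i) x))\<^sup>2) = ip (orth_proj ip (W i) x) x"
      unfolding ip_self[symmetric] by (rule ip_orth_proj_right[OF W orth_proj_in[OF W]])
    then show "of_real ((\<omega> i)\<^sup>2 * (norm (orth_proj ip (W i) x))\<^sup>2)
        = of_real ((\<omega> i)\<^sup>2) * ip (orth_proj ip (W i) x) x"
      by (simp only: of_real_mult)
  qed
  with has_sum_ip_fusion_frame_operator
  show "ip (fusion_frame_operator ip I W \<omega> x) x = of_real ?r" by (rule has_sum_unique)
qed

text \<open>The quadratic form of the operator is the fusion sum, which dominates the squared norm
  of the adjoint of \<open>K\<close>. On the closed range that adjoint is bounded below, so the
  constant is \<open>A * c\<^sup>2\<close>.\<close>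

lemma fusion_frame_operator_coercive:
  assumes K: "bounded_operator smul K" and cl: "closed (range K)"
  obtains c where "c > 0"
    and "\<And>v. v \<in> range K \<Longrightarrow> c * (norm v)\<^sup>2 \<le> inner (fusion_frame_operator ip I W \<omega> v) v"
proof -
  obtain A where A: "A > 0" "\<forall>x. A * (norm (hadjoint ip K x))\<^sup>2
      \<le> (\<Sum>\<^sub>\<infinity>i\<in>I. (\<omega> i)\<^sup>2 * (norm (orth_proj ip (W i) x))\<^sup>2)"
    using fusion_lower by (elim exE conjE)
  obtain c where c: "c > 0" "\<And>v. v \<in> range K \<Longrightarrow> c * norm v \<le> norm (hadjoint ip K v)"
    using hadjoint_bounded_below_on_range[OF K cl] by metis
  have "(A * c\<^sup>2) * (norm v)\<^sup>2 \<le> inner (fusion_frame_operator ip I W \<omega> v) v" if "v \<in> range K" for v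
  proof -
    have "(c * norm v)\<^sup>2 \<le> (norm (hadjoint ip K v))\<^sup>2"
      using c that by (intro power_mono) auto
    then have "A * (c * norm v)\<^sup>2 \<le> A * (norm (hadjoint ip K v))\<^sup>2"
      using A(1) by (intro mult_left_mono) auto
    then show ?thesis
      using A(2)[rule_format, of v] by (simp add: inner_fusion_frame_operator power_mult_distrib mult.assoc)
  qed
  then show thesis using A(1) c(1) by (intro that[of "A * c\<^sup>2"]) auto
qed

section \<open>Weighted local families, indexed by pairs\<close>

context
  fixes J :: "'i \<Rightarrow> 'j set" and e :: "'i \<Rightarrow> 'j \<Rightarrow> 'h" and C :: real
  assumes C: "C > 0"
    and summable: "\<And>i x. i \<in> I \<Longrightarrow> (\<lambda>j. (norm (ip x (e i j)))\<^sup>2) summable_on J i"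
    and upper: "\<And>i x. i \<in> I \<Longrightarrow> (\<Sum>\<^sub>\<infinity>j\<in>J i. (norm (ip x (e i j)))\<^sup>2) \<le> C * (norm (orth_proj ip (W i) x))\<^sup>2"
begin

text \<open>All terms are nonnegative, so summability over the pairs reduces to that of the row
  sums, and these are dominated by \<open>C\<close> times the fusion summands. The family
  \<open>e\<close> will be both the local frames and their duals.\<close>

lemma
  shows summable_weighted:
      "(\<lambda>k. (norm (ip x (case k of (i, j) \<Rightarrow> \<omega> i *\<^sub>R e i j)))\<^sup>2) summable_on (SIGMA i:I. J i)"
    and has_sum_weighted: "((\<lambda>i. (\<omega> i)\<^sup>2 * (\<Sum>\<^sub>\<infinity>j\<in>J i. (norm (ip x (e i j)))\<^sup>2)) has_sum
      (\<Sum>\<^sub>\<infinity>k\<in>(SIGMA i:I. J i). (norm (ip x (case k of (i, j) \<Rightarrow> \<omega> i *\<^sub>R e i j)))\<^sup>2)) I"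
proof -
  let ?s = "\<lambda>i. (\<omega> i)\<^sup>2 * (\<Sum>\<^sub>\<infinity>j\<in>J i. (norm (ip x (e i j)))\<^sup>2)"
  have row: "((\<lambda>j. (norm (ip x (case (i, j) of (i, j) \<Rightarrow> \<omega> i *\<^sub>R e i j)))\<^sup>2) has_sum ?s i) (J i)"
    if "i \<in> I" for i
    using has_sum_cmult_right[OF has_sum_infsum[OF summable[OF that, of x]], of "(\<omega> i)\<^sup>2"]
    by (simp add: ip_scaleR_right norm_mult power_mult_distrib)
  have "?s summable_on I"
  proof (rule summable_on_comparison_test)
    show "(\<lambda>i. C * ((\<omega> i)\<^sup>2 * (norm (orth_proj ip (W i) x))\<^sup>2)) summable_on I"
      by (rule summable_on_cmult_right[OF summable_fusion])
    show "?s i \<le> C * ((\<omega> i)\<^sup>2 * (norm (orth_proj ip (W i) x))\<^sup>2)" if "i \<in> I" for i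
      using mult_left_mono[OF upper[OF that, of x], of "(\<omega> i)\<^sup>2"] by (simp add: mult_ac)
    show "0 \<le> ?s i" for i by (intro mult_nonneg_nonneg infsum_nonneg) auto
  qed
  then show *: "(\<lambda>k. (norm (ip x (case k of (i, j) \<Rightarrow> \<omega> i *\<^sub>R e i j)))\<^sup>2) summable_on (SIGMA i:I. J i)"
    by (rule summable_on_SigmaI[OF row, rotated]) simp_all
  show "(?s has_sum
      (\<Sum>\<^sub>\<infinity>k\<in>(SIGMA i:I. J i). (norm (ip x (case k of (i, j) \<Rightarrow> \<omega> i *\<^sub>R e i j)))\<^sup>2)) I"
    by (rule has_sum_SigmaD[OF has_sum_infsum[OF *] row])
qed

lemma bessel_weighted: "bessel_sequence ip (SIGMA i:I. J i) (\<lambda>(i, j). \<omega> i *\<^sub>R e i j)"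
proof -
  obtain B where B: "B > 0"
    "\<forall>x. (\<Sum>\<^sub>\<infinity>i\<in>I. (\<omega> i)\<^sup>2 * (norm (orth_proj ip (W i) x))\<^sup>2) \<le> B * (norm x)\<^sup>2"
    using fusion_upper by (elim exE conjE)
  have "(\<Sum>\<^sub>\<infinity>k\<in>(SIGMA i:I. J i). (norm (ip x (case k of (i, j) \<Rightarrow> \<omega> i *\<^sub>R e i j)))\<^sup>2)
      \<le> (C * B) * (norm x)\<^sup>2" for x
  proof -
    have "(\<Sum>\<^sub>\<infinity>k\<in>(SIGMA i:I. J i). (norm (ip x (case k of (i, j) \<Rightarrow> \<omega> i *\<^sub>R e i j)))\<^sup>2)
        \<le> C * (\<Sum>\<^sub>\<infinity>i\<in>I. (\<omega> i)\<^sup>2 * (norm (orth_proj ip (W i) x))\<^sup>2)"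
    proof (rule has_sum_mono[OF has_sum_weighted has_sum_cmult_right[OF has_sum_infsum[OF summable_fusion]]])
      show "(\<omega> i)\<^sup>2 * (\<Sum>\<^sub>\<infinity>j\<in>J i. (norm (ip x (e i j)))\<^sup>2)
          \<le> C * ((\<omega> i)\<^sup>2 * (norm (orth_proj ip (W i) x))\<^sup>2)" if "i \<in> I" for i
        using mult_left_mono[OF upper[OF that, of x], of "(\<omega> i)\<^sup>2"] by (simp add: mult_ac)
    qed
    also have "\<dots> \<le> C * (B * (norm x)\<^sup>2)" using C B(2) by (intro mult_left_mono) auto
    finally show ?thesis by (simp only: mult.assoc)
  qed
  then show ?thesis
    unfolding bessel_sequence_def using C B(1) summable_weighted
    by (intro exI[of _ "C * B"] conjI allI) simp_all
qed

lemma K_frame_weighted: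
  assumes "L > 0"
    and lower: "\<And>i x. i \<in> I \<Longrightarrow> L * (norm (orth_proj ip (W i) x))\<^sup>2 \<le> (\<Sum>\<^sub>\<infinity>j\<in>J i. (norm (ip x (e i j)))\<^sup>2)"
  shows "K_frame ip K (SIGMA i:I. J i) (\<lambda>(i, j). \<omega> i *\<^sub>R e i j)"
proof -
  obtain A where A: "A > 0" "\<forall>x. A * (norm (hadjoint ip K x))\<^sup>2
      \<le> (\<Sum>\<^sub>\<infinity>i\<in>I. (\<omega> i)\<^sup>2 * (norm (orth_proj ip (W i) x))\<^sup>2)"
    using fusion_lower by (elim exE conjE)
  have "(L * A) * (norm (hadjoint ip K x))\<^sup>2
      \<le> (\<Sum>\<^sub>\<infinity>k\<in>(SIGMA i:I. J i). (norm (ip x (case k of (i, j) \<Rightarrow> \<omega> i *\<^sub>R e i j)))\<^sup>2)" for x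
  proof -
    have "(L * A) * (norm (hadjoint ip K x))\<^sup>2
        \<le> L * (\<Sum>\<^sub>\<infinity>i\<in>I. (\<omega> i)\<^sup>2 * (norm (orth_proj ip (W i) x))\<^sup>2)"
      unfolding mult.assoc using A \<open>L > 0\<close> by (intro mult_left_mono) auto
    also have "\<dots> \<le> (\<Sum>\<^sub>\<infinity>k\<in>(SIGMA i:I. J i). (norm (ip x (case k of (i, j) \<Rightarrow> \<omega> i *\<^sub>R e i j)))\<^sup>2)"
    proof (rule has_sum_mono[OF has_sum_cmult_right[OF has_sum_infsum[OF summable_fusion]] has_sum_weighted])
      show "L * ((\<omega> i)\<^sup>2 * (norm (orth_proj ip (W i) x))\<^sup>2)
          \<le> (\<omega> i)\<^sup>2 * (\<Sum>\<^sub>\<infinity>j\<in>J i. (norm (ip x (e i j)))\<^sup>2)" if "i \<in> I" for i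
        using mult_left_mono[OF lower[OF that, of x], of "(\<omega> i)\<^sup>2"] by (simp add: mult_ac)
    qed
    finally show ?thesis .
  qed
  moreover have "L * A > 0" using \<open>L > 0\<close> A(1) by simp
  moreover from bessel_weighted obtain B where "B > 0" and B: "\<forall>x.
      (\<lambda>k. (norm (ip x (case k of (i, j) \<Rightarrow> \<omega> i *\<^sub>R e i j)))\<^sup>2) summable_on (SIGMA i:I. J i) \<and>
      (\<Sum>\<^sub>\<infinity>k\<in>(SIGMA i:I. J i). (norm (ip x (case k of (i, j) \<Rightarrow> \<omega> i *\<^sub>R e i j)))\<^sup>2) \<le> B * (norm x)\<^sup>2"
    unfolding bessel_sequence_def by (elim exE conjE)
  ultimately have *: "\<forall>x.
      (\<lambda>k. (norm (ip x (case k of (i, j) \<Rightarrow> \<omega> i *\<^sub>R e i j)))\<^sup>2) summable_on (SIGMA i:I. J i) \<and>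
      (L * A) * (norm (hadjoint ip K x))\<^sup>2
        \<le> (\<Sum>\<^sub>\<infinity>k\<in>(SIGMA i:I. J i). (norm (ip x (case k of (i, j) \<Rightarrow> \<omega> i *\<^sub>R e i j)))\<^sup>2) \<and>
      (\<Sum>\<^sub>\<infinity>k\<in>(SIGMA i:I. J i). (norm (ip x (case k of (i, j) \<Rightarrow> \<omega> i *\<^sub>R e i j)))\<^sup>2) \<le> B * (norm x)\<^sup>2"
    by simp
  show ?thesis
    unfolding K_frame_def
    by (rule exI[of _ "L * A"], rule conjI, fact, rule exI[of _ B], rule conjI, fact, rule *)
qed

end

text \<open>Each of the two families contributes one factor \<open>\<omega> i\<close>. Summing the
  convergent series row by row leaves the projections with weights
  \<open>(\<omega> i)\<^sup>2\<close>, that is, the fusion frame operator.\<close>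

lemma weighted_duality:
  assumes dual: "\<And>i. i \<in> I \<Longrightarrow>
      ((\<lambda>j. ip x (e i j) * ip (d i j) y) has_sum ip (orth_proj ip (W i) x) y) (J i)"
    and sum: "((\<lambda>k. ip x (case k of (i, j) \<Rightarrow> \<omega> i *\<^sub>R e i j) * ip (case k of (i, j) \<Rightarrow> \<omega> i *\<^sub>R d i j) y)
      has_sum z) (SIGMA i:I. J i)"
  shows "z = ip (fusion_frame_operator ip I W \<omega> x) y"
proof -
  have "((\<lambda>i. of_real ((\<omega> i)\<^sup>2) * ip (orth_proj ip (W i) x) y) has_sum z) I"
  proof (rule has_sum_SigmaD[OF sum])
    fix i assume "i \<in> I"
    from has_sum_cmult_right[OF dual[OF this], of "of_real ((\<omega> i)\<^sup>2)"]
    show "((\<lambda>j. ip x (case (i, j) of (i, j) \<Rightarrow> \<omega> i *\<^sub>R e i j) * ip (case (i, j) of (i, j) \<Rightarrow> \<omega> i *\<^sub>R d i j) y)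
      has_sum of_real ((\<omega> i)\<^sup>2) * ip (orth_proj ip (W i) x) y) (J i)"
      by (simp add: ip_scaleR_left ip_scaleR_right power2_eq_square mult_ac)
  qed
  from this has_sum_ip_fusion_frame_operator show ?thesis by (rule has_sum_unique)
qed

end

section \<open>Inverse of the fusion frame operator on the range of K\<close>

context
  fixes K :: "'h \<Rightarrow> 'h" and I :: "'i set" and W :: "'i \<Rightarrow> 'h set" and \<omega> :: "'i \<Rightarrow> real"
  assumes K: "bounded_operator smul K" and cl: "closed (range K)"
    and fusion: "K_fusion_frame smul ip K I W \<omega>"
begin

lemma closed_subspace_fusion_image:
  "closed_subspace smul (fusion_frame_operator ip I W \<omega> ` range K)"
proof -
  obtain c where c: "c > 0"
    "\<And>v. v \<in> range K \<Longrightarrow> c * (norm v)\<^sup>2 \<le> inner (fusion_frame_operator ip I W \<omega> v) v"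
    using fusion_frame_operator_coercive[OF fusion K cl] by metis
  show ?thesis
    using bounded_operator_fusion_frame_operator[OF fusion] closed_subspace_range[OF K cl] c
    by (rule coercive_closed_image)
qed

lemma fusion_frame_operator_inj_on: "inj_on (fusion_frame_operator ip I W \<omega>) (range K)"
proof -
  obtain c where c: "c > 0"
    "\<And>v. v \<in> range K \<Longrightarrow> c * (norm v)\<^sup>2 \<le> inner (fusion_frame_operator ip I W \<omega> v) v"
    using fusion_frame_operator_coercive[OF fusion K cl] by metis
  show ?thesis
    using bounded_operator_fusion_frame_operator[OF fusion] closed_subspace_range[OF K cl] c
    by (rule coercive_inj_on)
qed

text \<open>The projection keeps the argument of the inverse inside the image of the range. The
  composite is thus meaningful on the whole space, and can be shown bounded and given an adjoint
  there.\<close>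

abbreviation restricted_inverse :: "'h \<Rightarrow> 'h" where
  "restricted_inverse x \<equiv> inv_fusion_frame_operator ip K I W \<omega>
     (orth_proj ip (fusion_frame_operator ip I W \<omega> ` range K) x)"

lemma restricted_inverse_in: "restricted_inverse x \<in> range K"
  unfolding inv_fusion_frame_operator_def
  by (rule inv_into_into[OF orth_proj_in[OF closed_subspace_fusion_image]])

lemma fusion_frame_operator_restricted_inverse:
  "fusion_frame_operator ip I W \<omega> (restricted_inverse x)
    = orth_proj ip (fusion_frame_operator ip I W \<omega> ` range K) x"
  unfolding inv_fusion_frame_operator_def
  by (rule f_inv_into_f[OF orth_proj_in[OF closed_subspace_fusion_image]])

lemma restricted_inverse_fusion_frame_operator:
  assumes "v \<in> range K"
  shows "restricted_inverse (fusion_frame_operator ip I W \<omega> v) = v"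
  unfolding orth_proj_ident[OF closed_subspace_fusion_image imageI[OF assms]] inv_fusion_frame_operator_def
  by (rule inv_into_f_f[OF fusion_frame_operator_inj_on assms])

text \<open>The value at \<open>x\<close> is the only vector of \<open>range K\<close> that the
  fusion frame operator sends to the projection of \<open>x\<close>; linearity follows from this
  uniqueness (\<open>T_eqI\<close>). Boundedness with constant \<open>1 / c\<close> is
  coercivity.\<close>

lemma bounded_operator_restricted_inverse: "bounded_operator smul restricted_inverse"
  unfolding bounded_operator_iff
proof (intro conjI allI)
  let ?S = "fusion_frame_operator ip I W \<omega>" and ?T = "restricted_inverse"
  note V = closed_subspace_range[OF K cl] and U = closed_subspace_fusion_image
    and S = bounded_operator_fusion_frame_operator[OF fusion]
    and P = bounded_operator_orth_proj[OF closed_subspace_fusion_image]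
  have V': "subspace (range K)" using V by (simp add: closed_subspace_def)
  have T_eqI: "?T x = w" if "w \<in> range K" "?S w = orth_proj ip (?S ` range K) x" for x w
    using fusion_frame_operator_inj_on fusion_frame_operator_restricted_inverse
      restricted_inverse_in that by (metis inj_onD)
  show "?T (x + y) = ?T x + ?T y" for x y
  proof (rule T_eqI)
    show "?T x + ?T y \<in> range K"
      by (rule subspace_add[OF V' restricted_inverse_in restricted_inverse_in])
  qed (simp only: bounded_operator_add[OF S] bounded_operator_add[OF P]
      fusion_frame_operator_restricted_inverse)
  show "?T (smul a x) = smul a (?T x)" for a x
  proof (rule T_eqI)
    show "smul a (?T x) \<in> range K" by (rule subspace_scale[OF V' restricted_inverse_in])
  qed (simp only: bounded_operator_smul[OF S] bounded_operator_smul[OF P]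
      fusion_frame_operator_restricted_inverse)
  obtain c where c: "c > 0" "\<And>v. v \<in> range K \<Longrightarrow> c * (norm v)\<^sup>2 \<le> inner (?S v) v"
    using fusion_frame_operator_coercive[OF fusion K cl] by metis
  have "norm (?T x) \<le> (1 / c) * norm x" for x
  proof -
    have "c * norm (?T x) \<le> norm (?S (?T x))"
      by (rule coercive_bounded_below[OF S V c restricted_inverse_in])
    also have "\<dots> \<le> norm x"
      unfolding fusion_frame_operator_restricted_inverse by (rule norm_orth_proj_le[OF U])
    finally show ?thesis using c(1) by (simp add: field_simps)
  qed
  then show "\<exists>C. \<forall>x. norm (?T x) \<le> C * norm x" by blast
qed

text \<open>The local bounds enter through uniform constants: \<open>b\<close> gives the Bessel
  bound of \<open>F\<close>, \<open>a\<close> its lower \<open>K\<close>-frame bound, and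
  \<open>1 / a\<close> the Bessel bound of the dual family \<open>D\<close>.\<close>

lemma K_duals_of_local_frames:
  assumes frame: "\<And>i. i \<in> I \<Longrightarrow> frame_of ip (W i) (J i) (f i) (A i) (B i)"
    and "a > 0" "\<And>i. i \<in> I \<Longrightarrow> a \<le> A i" and "b > 0" "\<And>i. i \<in> I \<Longrightarrow> B i \<le> b"
  defines "F \<equiv> \<lambda>(i, j). \<omega> i *\<^sub>R f i j"
    and "D \<equiv> \<lambda>(i, j). \<omega> i *\<^sub>R canonical_dual smul ip (W i) (J i) (f i) j"
  shows "K_dual smul ip K (SIGMA i:I. J i) (\<lambda>k. hadjoint ip K (F k)) (\<lambda>k. restricted_inverse (D k))"
    and "K_dual smul ip K (SIGMA i:I. J i) (\<lambda>k. hadjoint ip K (restricted_inverse (D k))) F"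
proof -
  let ?N = "SIGMA i:I. J i" and ?S = "fusion_frame_operator ip I W \<omega>" and ?T = restricted_inverse
  note W = fusion_subspace[OF fusion] and T = bounded_operator_restricted_inverse
    and K' = bounded_operator_hadjoint[OF K]
  have f_lower: "a * (norm (orth_proj ip (W i) x))\<^sup>2 \<le> (\<Sum>\<^sub>\<infinity>j\<in>J i. (norm (ip x (f i j)))\<^sup>2)"
    and f_upper: "(\<Sum>\<^sub>\<infinity>j\<in>J i. (norm (ip x (f i j)))\<^sup>2) \<le> b * (norm (orth_proj ip (W i) x))\<^sup>2"
    and d_upper: "(\<Sum>\<^sub>\<infinity>j\<in>J i. (norm (ip x (canonical_dual smul ip (W i) (J i) (f i) j)))\<^sup>2)
      \<le> (1 / a) * (norm (orth_proj ip (W i) x))\<^sup>2"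
    if i: "i \<in> I" for i x
  proof -
    let ?q = "(norm (orth_proj ip (W i) x))\<^sup>2"
    have "a * ?q \<le> A i * ?q" "B i * ?q \<le> b * ?q" "(1 / A i) * ?q \<le> (1 / a) * ?q"
      using assms(3,5)[OF i] \<open>a > 0\<close>
      by (auto intro!: mult_right_mono simp: frac_le)
    then show "a * ?q \<le> (\<Sum>\<^sub>\<infinity>j\<in>J i. (norm (ip x (f i j)))\<^sup>2)"
      "(\<Sum>\<^sub>\<infinity>j\<in>J i. (norm (ip x (f i j)))\<^sup>2) \<le> b * ?q"
      "(\<Sum>\<^sub>\<infinity>j\<in>J i. (norm (ip x (canonical_dual smul ip (W i) (J i) (f i) j)))\<^sup>2) \<le> (1 / a) * ?q"
      using frame_lower[OF W[OF i] frame[OF i], of x] frame_upper[OF W[OF i] frame[OF i], of x]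
        canonical_dual_upper[OF W[OF i] frame[OF i], of x] by linarith+
  qed
  have F: "bessel_sequence ip ?N F" "K_frame ip K ?N F"
    unfolding F_def
    by (rule bessel_weighted[OF fusion \<open>b > 0\<close> summable_frame_coeffs[OF W frame] f_upper];
      assumption)
      (rule K_frame_weighted[OF fusion \<open>b > 0\<close> summable_frame_coeffs[OF W frame] f_upper \<open>a > 0\<close> f_lower];
      assumption)
  have D: "bessel_sequence ip ?N D"
    unfolding D_def
    by (rule bessel_weighted[OF fusion, of "1 / a"])
      (use \<open>a > 0\<close> summable_canonical_dual_coeffs[OF W frame] d_upper in auto)
  have FD: "z = ip (?S x) y" if "((\<lambda>k. ip x (F k) * ip (D k) y) has_sum z) ?N" for x y z
    using weighted_duality[OF fusion has_sum_frame_dual[OF W frame]] that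
    unfolding F_def D_def by blast
  have DF: "z = ip (?S x) y" if "((\<lambda>k. ip x (D k) * ip (F k) y) has_sum z) ?N" for x y z
    using weighted_duality[OF fusion has_sum_dual_frame[OF W frame]] that
    unfolding F_def D_def by blast
  note KF = bessel_sequence_image[OF K' F(1)] and TD = bessel_sequence_image[OF T D]
  have dual1: "z = ip (K x) y"
    if "((\<lambda>k. ip x (hadjoint ip K (F k)) * ip (?T (D k)) y) has_sum z) ?N" for x y z
  proof -
    have "z = ip (?S (K x)) (hadjoint ip ?T y)"
      by (rule FD) (use that in \<open>simp only: hadjoint[OF K] hadjoint[OF T]\<close>)
    also have "\<dots> = ip (?T (?S (K x))) y" by (rule hadjoint[OF T, symmetric])
    finally show ?thesis by (simp only: restricted_inverse_fusion_frame_operator[OF rangeI])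
  qed
  show "K_dual smul ip K ?N (\<lambda>k. hadjoint ip K (F k)) (\<lambda>k. ?T (D k))"
    by (rule K_dualI[OF K KF cl K_frame_of_duality[OF K KF TD dual1] dual1])
  \<comment> \<open>The restriction on \<open>y\<close> is essential here: after the moves by
    adjoints, the restricted inverse acts on the image of \<open>y\<close> under \<open>?S\<close>,
    and it undoes \<open>?S\<close> only on \<open>range K\<close>.\<close>
  have dual2: "z = ip (K x) y"
    if y: "y \<in> range K" and z: "((\<lambda>k. ip x (hadjoint ip K (?T (D k))) * ip (F k) y) has_sum z) ?N" for x y z
  proof -
    have "z = ip (?S (hadjoint ip ?T (K x))) y"
      by (rule DF) (use z in \<open>simp only: hadjoint[OF K, symmetric] hadjoint_right[OF T]\<close>)
    also have "\<dots> = ip (K x) (?T (?S y))"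
      by (simp only: fusion_frame_operator_swap[OF fusion] hadjoint_right[OF T])
    finally show ?thesis by (simp only: restricted_inverse_fusion_frame_operator[OF y])
  qed
  show "K_dual smul ip K ?N (\<lambda>k. hadjoint ip K (?T (D k))) F"
    by (rule K_dualI[OF K bessel_sequence_image[OF K' TD] cl F(2) dual2])
qed

end

end

theorem theorem2p6:
  fixes smul :: "'k::real_or_complex \<Rightarrow> 'h::{real_inner,banach} \<Rightarrow> 'h"
    and ip :: "'h \<Rightarrow> 'h \<Rightarrow> 'k"
    and K :: "'h \<Rightarrow> 'h"
    and I :: "'i set" and W :: "'i \<Rightarrow> 'h set" and \<omega> :: "'i \<Rightarrow> real"
    and J :: "'i \<Rightarrow> 'j set" and f :: "'i \<Rightarrow> 'j \<Rightarrow> 'h"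
    and A B :: "'i \<Rightarrow> real"
  assumes "hilbert_space smul ip"
    and "separable_space (euclidean :: 'h topology)"
    and "bounded_operator smul K" and "closed (range K)"
    and "countable I" and "\<And>i. i \<in> I \<Longrightarrow> countable (J i)"
    and "K_fusion_frame smul ip K I W \<omega>"
    and "\<And>i. i \<in> I \<Longrightarrow> frame_of ip (W i) (J i) (f i) (A i) (B i)"
    and "0 < (INF i\<in>I. ereal (A i))" and "(SUP i\<in>I. ereal (B i)) < \<infinity>"
  shows "K_dual smul ip K (SIGMA i:I. J i)
           (\<lambda>(i, j). hadjoint ip K (\<omega> i *\<^sub>R f i j))
           (\<lambda>(i, j). inv_fusion_frame_operator ip K I W \<omega>
              (orth_proj ip (fusion_frame_operator ip I W \<omega> ` range K)
                (\<omega> i *\<^sub>R canonical_dual smul ip (W i) (J i) (f i) j)))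
       \<and> K_dual smul ip K (SIGMA i:I. J i)
           (\<lambda>(i, j). hadjoint ip K (inv_fusion_frame_operator ip K I W \<omega>
              (orth_proj ip (fusion_frame_operator ip I W \<omega> ` range K)
                (\<omega> i *\<^sub>R canonical_dual smul ip (W i) (J i) (f i) j))))
           (\<lambda>(i, j). \<omega> i *\<^sub>R f i j)"
proof -
  interpret hilbert_space smul ip by fact
  \<comment> \<open>A real number strictly below the infimum also exists when \<open>I\<close> is
    empty and the infimum is infinite, so no case distinction arises.\<close>
  obtain a where a: "0 < ereal a" "ereal a < (INF i\<in>I. ereal (A i))"
    using ereal_dense2[OF assms(9)] by blast
  have aA: "a \<le> A i" if "i \<in> I" for i
  proof -
    have "ereal a \<le> ereal (A i)"
      using a(2) INF_lower[OF that, of "\<lambda>i. ereal (A i)"] by (meson less_imp_le order_trans)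
    then show ?thesis by simp
  qed
  obtain b where b: "(SUP i\<in>I. ereal (B i)) < ereal b"
    using ereal_dense2[OF assms(10)] by blast
  \<comment> \<open>For empty \<open>I\<close> the supremum is minus infinity and \<open>b\<close>
    may fail to be positive; the maximum with 1 secures a positive upper bound.\<close>
  have Bb: "B i \<le> max b 1" if "i \<in> I" for i
  proof -
    have "ereal (B i) \<le> ereal b"
      using b SUP_upper[OF that, of "\<lambda>i. ereal (B i)"] by (meson less_imp_le order_trans)
    then show ?thesis by simp
  qed
  have "0 < a" using a(1) by simp
  moreover have "0 < max b 1" by simp
  ultimately show ?thesis
    using K_duals_of_local_frames[OF assms(3,4,7,8) _ aA _ Bb]
    by (simp add: case_prod_unfold)
qed

end
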